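(* Given an $n\times n$ symmetric diagonally dominant matrix $A$, let $w_{\max}=\max_{i,j}|A_{i,j}|$ and $w_{\min}=\min_{i,j:\,A_{i,j}\ne0}|A_{i,j}|$, and assume $w_{\max}/w_{\min}=\mathrm{poly}(n)$. Let $\varepsilon\in(1/n,1)$. Then one can construct a (randomized) sketch of $A$ that gives a $(1+\varepsilon,0.01)$-approximation to $x^TAx$ for any fixed $x\in\mathbb R^n$. The size of this sketch is $\tilde O(n/\varepsilon^{8/5})$ bits.
   Context: A symmetric diagonally dominant (SDD) matrix is a real symmetric matrix with $A_{i,i}\ge\sum_{j\ne i}|A_{i,j}|$ for all $i$. $\mathrm{poly}(n)$ means at most $n^C$ for some fixed constant $C$ (on which hidden constants may depend). A random variable $X$ is a $(1+\varepsilon,\delta)$-approximation of $Y$ if $\Pr[(1-\varepsilon)Y\le X\le(1+\varepsilon)Y]\ge1-\delta$. The estimate is computed from the sketch and $x$ only, without access to $A$. $\tilde O(f)$ denotes $f\cdot(\log f)^{O(1)}$; it suppresses the distinction between bits and machine words, where one machine word stores an index, a matrix entry or a sum of matrix entries. *)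

theory Defs
  imports "HOL-Probability.Probability_Mass_Function" "Jordan_Normal_Form.Matrix"
begin

definition sdd :: "real mat \<Rightarrow> bool" where
  "sdd A \<longleftrightarrow> square_mat A \<and> transpose_mat A = A \<and>
     (\<forall>i<dim_row A. (\<Sum>j\<in>{..<dim_row A} - {i}. \<bar>A $$ (i, j)\<bar>) \<le> A $$ (i, i))"

definition w_max :: "real mat \<Rightarrow> real" where
  "w_max A = Max {\<bar>A $$ (i, j)\<bar> | i j. i < dim_row A \<and> j < dim_col A}"

(* For the zero matrix this is Min {}, an unspecified value. It is harmless in the ratio
   w_max A / w_min A, whose numerator is then 0: the zero matrix satisfies every upper bound
   n powr C on the ratio. *)
definition w_min :: "real mat \<Rightarrow> real" where
  "w_min A = Min {\<bar>A $$ (i, j)\<bar> | i j. i < dim_row A \<and> j < dim_col A \<and> A $$ (i, j) \<noteq> 0}"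

definition quad_form :: "real mat \<Rightarrow> real vec \<Rightarrow> real" where
  "quad_form A x = scalar_prod x (mult_mat_vec A x)"

datatype mword = Index nat | Value real

(* The words that may occur in a sketch of A. Restricting Value to sums of entries of A
   (single entries are the sums over singletons) is essential: one unrestricted real number could
   encode the whole matrix, whereas for an integer matrix with polynomially bounded entries each
   word admitted here takes only polynomially many values, that is, O(log n) bits. *)
definition machine_words :: "real mat \<Rightarrow> mword set" where
  "machine_words A = Index ` {..<dim_row A} \<union>
     (\<lambda>S. Value (\<Sum>p\<in>S. A $$ p)) ` Pow ({..<dim_row A} \<times> {..<dim_col A})"

(* The random variable X, on the sample space given by p, is a (1 + eps, delta)-approximation
   of the number Y. *)
definition approximates :: "'a pmf \<Rightarrow> ('a \<Rightarrow> real) \<Rightarrow> real \<Rightarrow> real \<Rightarrow> real \<Rightarrow> bool" where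
  "approximates p X eps delta Y \<longleftrightarrow>
     measure_pmf.prob p {s. (1 - eps) * Y \<le> X s \<and> X s \<le> (1 + eps) * Y} \<ge> 1 - delta"

(* Bounds of the form f * (log f)^O(1): a function is in soft-O of f if it is bounded by
   soft_bound K c f for some constants K and c. *)
definition soft_bound :: "real \<Rightarrow> nat \<Rightarrow> real \<Rightarrow> real" where
  "soft_bound K c f = K * (f * ln f ^ c)"

end

theory Submission
  imports Defs
begin

text \<open>Let \<open>x\<^sup>T A x\<close> be the quadratic form of an SDD matrix. Up to a nonnegative diagonal part, it is half
  the energy \<open>\<Sum>\<^sub>e w\<^sub>e (y\<^sub>u - y\<^sub>v)\<^sup>2\<close> of a weighted graph on the \<open>2 n\<close> signed indices, evaluated at
  \<open>y = (x, -x)\<close>. The edges of this graph split into \<open>\<phi>\<close>-expanders, \<open>\<phi> = 1 / O(log n)\<close>, which have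
  only \<open>O(n log n)\<close> vertices in total.

  In a single expander shift \<open>y\<close> by its weighted mean to \<open>z\<close>. The energy is \<open>\<Sum>\<^sub>u D\<^sub>u z\<^sub>u\<^sup>2 - 2 \<Sum>\<^sub>e w\<^sub>e z\<^sub>u z\<^sub>v\<close>, where
  the degrees \<open>D\<^sub>u\<close> are stored exactly, and by Cheeger's inequality it is at least \<open>\<phi>\<^sup>2 / 2\<close> times
  \<open>\<Sum>\<^sub>u D\<^sub>u z\<^sub>u\<^sup>2\<close>. The second sum is estimated from about \<open>s\<close> sampled edges per vertex, drawn with
  probability proportional to \<open>w\<^sub>e (1 / D\<^sub>u + 1 / D\<^sub>v)\<close>, except for at most \<open>s\<close> heavy edges per vertex that
  are stored. The variance is at most \<open>(\<Sum>\<^sub>u D\<^sub>u z\<^sub>u\<^sup>2)\<^sup>2 / s\<^sup>2\<close>, so that \<open>s = O(1 / (\<epsilon> \<phi>\<^sup>2))\<close> suffices. The size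
  is \<open>n / \<epsilon>\<close> up to logarithms, which is even smaller than \<open>n / \<epsilon>\<^sup>8\<^sup>/\<^sup>5\<close>.\<close>

section \<open>Weighted graphs and Cheeger's inequality\<close>

text \<open>A set of pairs is an undirected graph, in which every edge has an arbitrary orientation.\<close>

definition mass :: "('v \<times> 'v \<Rightarrow> real) \<Rightarrow> ('v \<times> 'v) set \<Rightarrow> ('v \<Rightarrow> real) \<Rightarrow> real" where
  "mass w H f = (\<Sum>e\<in>H. w e * (f (fst e) + f (snd e)))"

definition vol :: "('v \<times> 'v \<Rightarrow> real) \<Rightarrow> ('v \<times> 'v) set \<Rightarrow> 'v set \<Rightarrow> real" where
  "vol w H S = mass w H (indicator S)"

definition cut :: "('v \<times> 'v \<Rightarrow> real) \<Rightarrow> ('v \<times> 'v) set \<Rightarrow> 'v set \<Rightarrow> real" where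
  "cut w H S = (\<Sum>e\<in>H. w e * \<bar>indicator S (fst e) - indicator S (snd e)\<bar>)"

definition energy :: "('v \<times> 'v \<Rightarrow> real) \<Rightarrow> ('v \<times> 'v) set \<Rightarrow> ('v \<Rightarrow> real) \<Rightarrow> real" where
  "energy w H y = (\<Sum>e\<in>H. w e * (y (fst e) - y (snd e))\<^sup>2)"

definition verts :: "('v \<times> 'v) set \<Rightarrow> 'v set" where
  "verts H = fst ` H \<union> snd ` H"

definition wdeg :: "('v \<times> 'v \<Rightarrow> real) \<Rightarrow> ('v \<times> 'v) set \<Rightarrow> 'v \<Rightarrow> real" where
  "wdeg w H u = vol w H {u}"

text \<open>Conductance at least \<phi>. \<open>S\<close> may be any set, since points outside
  \<open>verts H\<close> contribute neither volume nor cut.\<close>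

definition expander :: "real \<Rightarrow> ('v \<times> 'v \<Rightarrow> real) \<Rightarrow> ('v \<times> 'v) set \<Rightarrow> bool" where
  "expander \<phi> w H \<longleftrightarrow> (\<forall>S. 2 * vol w H S \<le> vol w H UNIV \<longrightarrow> \<phi> * vol w H S \<le> cut w H S)"

lemma finite_verts [simp]: "finite H \<Longrightarrow> finite (verts H)"
  by (simp add: verts_def)

lemma mass_add: "mass w H (\<lambda>u. f u + g u) = mass w H f + mass w H g"
  by (simp add: mass_def sum.distrib[symmetric] algebra_simps)

lemma mass_cmult: "mass w H (\<lambda>u. c * f u) = c * mass w H f"
  by (simp add: mass_def sum_distrib_left algebra_simps)

lemma mass_nonneg:
  assumes "\<And>e. e \<in> H \<Longrightarrow> 0 \<le> w e" "\<And>u. 0 \<le> f u"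
  shows "0 \<le> mass w H f"
  unfolding mass_def using assms by (intro sum_nonneg mult_nonneg_nonneg add_nonneg_nonneg) auto

lemma vol_mono:
  assumes "\<And>e. e \<in> H \<Longrightarrow> 0 \<le> w e" "S \<subseteq> T"
  shows "vol w H S \<le> vol w H T"
  unfolding vol_def mass_def using assms
  by (intro sum_mono mult_left_mono add_mono) (auto simp: indicator_def)

lemma vol_compl: "vol w H (- S) = vol w H UNIV - vol w H S"
  unfolding vol_def mass_def sum_subtractf[symmetric]
  by (intro sum.cong) (auto simp: indicator_def)

lemma vol_nonneg: "(\<And>e. e \<in> H \<Longrightarrow> 0 \<le> w e) \<Longrightarrow> 0 \<le> vol w H S"
  unfolding vol_def by (rule mass_nonneg) auto

text \<open>Exchange of the sums over edges and vertices. In this form a mass can be computed from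
  the degrees alone, which the sketch stores.\<close>

lemma mass_eq_sum_wdeg:
  assumes "finite H"
  shows "mass w H f = (\<Sum>u\<in>verts H. wdeg w H u * f u)"
proof -
  have "(\<Sum>u\<in>verts H. wdeg w H u * f u)
      = (\<Sum>u\<in>verts H. \<Sum>e\<in>H. w e * (indicator {u} (fst e) * f u + indicator {u} (snd e) * f u))"
    unfolding wdeg_def vol_def mass_def sum_distrib_right
    by (intro sum.cong) (auto simp: algebra_simps)
  also have "\<dots> = (\<Sum>e\<in>H. \<Sum>u\<in>verts H. w e * (indicator {u} (fst e) * f u + indicator {u} (snd e) * f u))"
    by (rule sum.swap)
  also have "\<dots> = mass w H f"
    unfolding mass_def
  proof (rule sum.cong)
    fix e assume e: "e \<in> H"
    have *: "(\<Sum>u\<in>verts H. indicator {u} v * f u) = f v" if "v \<in> verts H" for v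
    proof -
      have "(\<Sum>u\<in>verts H. indicator {u} v * f u) = (\<Sum>u\<in>verts H. if u = v then f u else 0)"
        by (intro sum.cong) (auto simp: indicator_def)
      then show ?thesis using that assms by simp
    qed
    have "fst e \<in> verts H" "snd e \<in> verts H" using e by (auto simp: verts_def)
    then show "(\<Sum>u\<in>verts H. w e * (indicator {u} (fst e) * f u + indicator {u} (snd e) * f u))
        = w e * (f (fst e) + f (snd e))"
      by (simp add: sum_distrib_left[symmetric] sum.distrib *)
  qed simp
  finally show ?thesis ..
qed

text \<open>A layer-cake argument: subtracting the least positive value of \<open>f\<close> on its support \<open>S\<close> lowers
  the left-hand side by a multiple of \<open>vol S\<close> and the right-hand side by the same multiple of \<open>cut S\<close>.\<close>

lemma expander_sum_abs_diff:
  fixes f :: "'v \<Rightarrow> real"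
  assumes w: "\<And>e. e \<in> H \<Longrightarrow> 0 \<le> w e" and exp: "expander \<phi> w H"
    and "finite {u. f u \<noteq> 0}" "\<And>u. 0 \<le> f u"
    and "2 * vol w H {u. 0 < f u} \<le> vol w H UNIV"
  shows "\<phi> * mass w H f \<le> (\<Sum>e\<in>H. w e * \<bar>f (fst e) - f (snd e)\<bar>)"
  using assms(3-)
proof (induction "card {u. f u \<noteq> 0}" arbitrary: f rule: less_induct)
  case less
  define S where "S = {u. f u \<noteq> 0}"
  have S': "S = {u. 0 < f u}" using less.prems(2) by (force simp: S_def less_le)
  show ?case
  proof (cases "S = {}")
    case True
    then have "f = (\<lambda>_. 0)" by (auto simp: S_def)
    then show ?thesis by (simp add: mass_def)
  next
    case False
    have fin: "finite S" using less.prems by (simp add: S_def)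
    define m where "m = Min (f ` S)"
    have m_in: "m \<in> f ` S" unfolding m_def using fin False by (intro Min_in) auto
    then have m0: "0 < m" by (auto simp: S')
    have m_le: "m \<le> f u" if "u \<in> S" for u unfolding m_def using fin that by (intro Min_le) auto
    define g where "g u = f u - m * indicator S u" for u
    have g0: "0 \<le> g u" for u
      using m_le[of u] less.prems(2)[of u] by (auto simp: g_def indicator_def)
    have sub: "{u. g u \<noteq> 0} \<subset> S"
    proof
      show "{u. g u \<noteq> 0} \<subseteq> S" by (auto simp: g_def S_def indicator_def)
      obtain u where "u \<in> S" "f u = m" using m_in by auto
      then have "u \<notin> {u. g u \<noteq> 0}" by (simp add: g_def)
      then show "{u. g u \<noteq> 0} \<noteq> S" using \<open>u \<in> S\<close> by blast
    qed
    have "{u. 0 < g u} \<subseteq> {u. 0 < f u}" using sub S' by force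
    then have vg: "2 * vol w H {u. 0 < g u} \<le> vol w H UNIV"
      using vol_mono[of H w "{u. 0 < g u}" "{u. 0 < f u}", OF w] less.prems(3) by simp
    have IH: "\<phi> * mass w H g \<le> (\<Sum>e\<in>H. w e * \<bar>g (fst e) - g (snd e)\<bar>)"
      using sub fin vg by (intro less.hyps g0) (auto simp: S_def intro: psubset_card_mono finite_subset)
    have c: "\<phi> * vol w H S \<le> cut w H S"
      using exp less.prems(3) S' by (simp add: expander_def)
    have f_eq: "f = (\<lambda>u. g u + m * indicator S u)" by (simp add: g_def)
    have "mass w H f = mass w H g + m * vol w H S"
      unfolding vol_def by (subst f_eq) (simp add: mass_add mass_cmult)
    then have "\<phi> * mass w H f = \<phi> * mass w H g + m * (\<phi> * vol w H S)"
      by (simp add: algebra_simps)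
    also have "\<dots> \<le> (\<Sum>e\<in>H. w e * \<bar>g (fst e) - g (snd e)\<bar>) + m * cut w H S"
      using IH c m0 by (intro add_mono mult_left_mono) auto
    also have "\<dots> = (\<Sum>e\<in>H. w e * (\<bar>g (fst e) - g (snd e)\<bar>
        + m * \<bar>indicator S (fst e) - indicator S (snd e)\<bar>))"
      by (simp add: cut_def sum_distrib_left sum.distrib algebra_simps)
    also have "\<dots> = (\<Sum>e\<in>H. w e * \<bar>f (fst e) - f (snd e)\<bar>)"
    proof (intro sum.cong arg_cong2[of _ _ _ _ "(*)"] refl)
      fix e
      \<comment> \<open>\<open>g\<close> vanishes off \<open>S\<close>, so \<open>g\<close> and the
        indicator of \<open>S\<close> never change in opposite directions between two vertices and
        nothing cancels.\<close>
      have *: "\<bar>g u - g v\<bar> + m * \<bar>indicator S u - indicator S v\<bar> = \<bar>f u - f v\<bar>" for u v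
        using g0[of u] g0[of v] m0 less.prems(2)[of u] less.prems(2)[of v]
        by (auto simp: g_def S_def indicator_def split: if_splits)
      show "\<bar>g (fst e) - g (snd e)\<bar> + m * \<bar>indicator S (fst e) - indicator S (snd e)\<bar>
          = \<bar>f (fst e) - f (snd e)\<bar>" by (rule *)
    qed
    finally show ?thesis .
  qed
qed

text \<open>Apply the linear inequality to \<open>p\<^sup>2\<close>, factor
  \<open>\<bar>a\<^sup>2 - b\<^sup>2\<bar>\<close> as \<open>\<bar>a - b\<bar> * (a + b)\<close> and
  split this product by Young's inequality. The split is weighted so that exactly half of the mass
  term can be absorbed into the left-hand side.\<close>

lemma expander_mass_square_le:
  fixes p :: "'v \<Rightarrow> real"
  assumes w: "\<And>e. e \<in> H \<Longrightarrow> 0 \<le> w e" and exp: "expander \<phi> w H" and "0 < \<phi>"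
    and "finite {u. p u \<noteq> 0}" and p0: "\<And>u. 0 \<le> p u"
    and "2 * vol w H {u. 0 < p u} \<le> vol w H UNIV"
  shows "\<phi>\<^sup>2 / 2 * mass w H (\<lambda>u. (p u)\<^sup>2) \<le> energy w H p"
proof -
  have 1: "\<bar>a\<^sup>2 - b\<^sup>2\<bar> \<le> (a - b)\<^sup>2 / \<phi> + \<phi> / 2 * (a\<^sup>2 + b\<^sup>2)"
    if "0 \<le> a" "0 \<le> b" for a b :: real
  proof -
    have "\<bar>a\<^sup>2 - b\<^sup>2\<bar> = \<bar>a - b\<bar> * (a + b)"
      using that by (simp add: power2_eq_square square_diff_square_factored abs_mult)
    moreover have "0 \<le> (\<bar>a - b\<bar> - \<phi> / 2 * (a + b))\<^sup>2 / \<phi>" using \<open>0 < \<phi>\<close> by simp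
    moreover have "(\<bar>a - b\<bar> - \<phi> / 2 * (a + b))\<^sup>2 / \<phi>
        = (a - b)\<^sup>2 / \<phi> - \<bar>a - b\<bar> * (a + b) + \<phi> / 4 * (a + b)\<^sup>2"
      using \<open>0 < \<phi>\<close> by (simp add: power2_diff field_simps power2_eq_square)
    moreover have "(a + b)\<^sup>2 \<le> 2 * (a\<^sup>2 + b\<^sup>2)"
      using zero_le_power2[of "a - b"] by (simp add: power2_sum power2_diff)
    then have "\<phi> / 4 * (a + b)\<^sup>2 \<le> \<phi> / 4 * (2 * (a\<^sup>2 + b\<^sup>2))"
      using \<open>0 < \<phi>\<close> by (intro mult_left_mono) auto
    ultimately show ?thesis by (simp add: algebra_simps)
  qed
  have "\<phi> * mass w H (\<lambda>u. (p u)\<^sup>2) \<le> (\<Sum>e\<in>H. w e * \<bar>(p (fst e))\<^sup>2 - (p (snd e))\<^sup>2\<bar>)"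
  proof (rule expander_sum_abs_diff[OF w exp])
    have "{u. 0 < (p u)\<^sup>2} = {u. 0 < p u}" using p0 by (auto simp: less_le)
    then show "2 * vol w H {u. 0 < (p u)\<^sup>2} \<le> vol w H UNIV" using assms(6) by simp
  qed (use assms in auto)
  also have "\<dots> \<le> (\<Sum>e\<in>H. w e * ((p (fst e) - p (snd e))\<^sup>2 / \<phi>
      + \<phi> / 2 * ((p (fst e))\<^sup>2 + (p (snd e))\<^sup>2)))"
    by (intro sum_mono mult_left_mono 1 p0 w)
  also have "\<dots> = energy w H p / \<phi> + \<phi> / 2 * mass w H (\<lambda>u. (p u)\<^sup>2)"
    by (simp add: energy_def mass_def sum_divide_distrib sum_distrib_left sum.distrib algebra_simps)
  finally have "\<phi> / 2 * mass w H (\<lambda>u. (p u)\<^sup>2) \<le> energy w H p / \<phi>" by linarith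
  then show ?thesis using \<open>0 < \<phi>\<close> by (simp add: field_simps power2_eq_square)
qed

lemma energy_shift: "energy w H (\<lambda>u. y u - c) = energy w H y"
  by (simp add: energy_def)

text \<open>Take the least value \<open>c\<close> with at most half of the volume above it. More
  than half of the volume lies above the next smaller value \<open>c'\<close>, and what lies below
  \<open>c\<close> is the complement of that set.\<close>

lemma weighted_median:
  fixes y :: "'v \<Rightarrow> real"
  assumes w: "\<And>e. e \<in> H \<Longrightarrow> 0 \<le> w e" and fin: "finite {u. y u \<noteq> 0}"
  obtains c where "2 * vol w H {u. c < y u} \<le> vol w H UNIV" "2 * vol w H {u. y u < c} \<le> vol w H UNIV"
proof -
  \<comment> \<open>Only finitely many values occur; 0 stands for all points outside the support of
    \<open>y\<close>.\<close>
  define Y where "Y = insert 0 (y ` {u. y u \<noteq> 0})"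
  have finY: "finite Y" and rng: "y u \<in> Y" for u using fin by (auto simp: Y_def)
  define G where "G = {c \<in> Y. 2 * vol w H {u. c < y u} \<le> vol w H UNIV}"
  have "{u. Max Y < y u} = {}" using Max_ge[OF finY rng] by (auto simp: not_less)
  then have "2 * vol w H {u. Max Y < y u} \<le> vol w H UNIV"
    using vol_nonneg[of H w UNIV] w by (simp add: vol_def[of _ _ "{}"] mass_def)
  moreover have "Max Y \<in> Y" using finY by (intro Max_in) (auto simp: Y_def)
  ultimately have "G \<noteq> {}" by (auto simp: G_def)
  have finG: "finite G" using finY by (simp add: G_def)
  define c where "c = Min G"
  have c: "c \<in> G" unfolding c_def using finG \<open>G \<noteq> {}\<close> by (rule Min_in)
  have "2 * vol w H {u. y u < c} \<le> vol w H UNIV"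
  proof (cases "{v \<in> Y. v < c} = {}")
    case True
    then have "{u. y u < c} = {}" using rng by blast
    then show ?thesis
      using vol_nonneg[of H w UNIV] w by (simp add: vol_def[of _ _ "{}"] mass_def)
  next
    case False
    define c' where "c' = Max {v \<in> Y. v < c}"
    have c': "c' \<in> {v \<in> Y. v < c}" unfolding c'_def using finY False by (intro Max_in) auto
    have "c' \<notin> G" using c' Min_le[OF finG, of c'] by (auto simp: c_def)
    then have "vol w H UNIV < 2 * vol w H {u. c' < y u}" using c' by (auto simp: G_def)
    moreover have "{u. y u < c} = - {u. c' < y u}"
    proof -
      have "y u < c \<longleftrightarrow> \<not> c' < y u" for u
        using c' Max_ge[of "{v \<in> Y. v < c}" "y u"] finY rng[of u] unfolding c'_def[symmetric] by force
      then show ?thesis by blast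
    qed
    ultimately show ?thesis by (simp add: vol_compl)
  qed
  then show ?thesis using that[of c] c by (simp add: G_def)
qed

definition wmean :: "('v \<times> 'v \<Rightarrow> real) \<Rightarrow> ('v \<times> 'v) set \<Rightarrow> ('v \<Rightarrow> real) \<Rightarrow> real" where
  "wmean w H y = mass w H y / vol w H UNIV"

text \<open>Parallel axis identity: moving the centre from the mean \<open>m\<close> to
  \<open>c\<close> adds \<open>(m - c)\<^sup>2 * vol w H UNIV\<close>.\<close>

lemma wmean_minimizes:
  assumes w: "\<And>e. e \<in> H \<Longrightarrow> 0 \<le> w e" and "finite H"
  shows "mass w H (\<lambda>u. (y u - wmean w H y)\<^sup>2) \<le> mass w H (\<lambda>u. (y u - c)\<^sup>2)"
proof (cases "vol w H UNIV = 0")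
  \<comment> \<open>Here \<open>wmean\<close> divides by zero, but then all weights on
    \<open>H\<close> vanish and both sides are 0.\<close>
  case True
  have "\<forall>e\<in>H. w e * 2 = 0"
    using True w \<open>finite H\<close>
    by (subst sum_nonneg_eq_0_iff[symmetric]) (auto simp: vol_def mass_def)
  then show ?thesis by (simp add: mass_def)
next
  case False
  define m where "m = wmean w H y"
  have "mass w H (\<lambda>u. (y u - c)\<^sup>2)
      = mass w H (\<lambda>u. (y u - m)\<^sup>2 + (2 * (m - c) * y u + (c\<^sup>2 - m\<^sup>2) * indicator UNIV u))"
    by (rule arg_cong[of _ _ "mass w H"]) (auto simp: fun_eq_iff power2_eq_square algebra_simps)
  also have "\<dots> = mass w H (\<lambda>u. (y u - m)\<^sup>2)
      + (2 * (m - c) * mass w H y + (c\<^sup>2 - m\<^sup>2) * vol w H UNIV)"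
    by (simp only: mass_add mass_cmult vol_def)
  also have "mass w H y = m * vol w H UNIV" using False by (simp add: m_def wmean_def)
  also have "2 * (m - c) * (m * vol w H UNIV) + (c\<^sup>2 - m\<^sup>2) * vol w H UNIV = (m - c)\<^sup>2 * vol w H UNIV"
    by (simp add: power2_eq_square algebra_simps)
  finally show ?thesis using vol_nonneg[of H w UNIV, OF w] by (simp add: m_def)
qed

text \<open>Cheeger's inequality: the positive and the negative part of \<open>y - c\<close>, for a median \<open>c\<close>, are each
  supported on at most half of the volume; passing to the mean only decreases the left-hand side.\<close>

lemma expander_spectral_gap:
  fixes y :: "'v \<Rightarrow> real"
  assumes w: "\<And>e. e \<in> H \<Longrightarrow> 0 \<le> w e" and "expander \<phi> w H" and "0 < \<phi>" and "finite H"
  shows "\<phi>\<^sup>2 / 2 * mass w H (\<lambda>u. (y u - wmean w H y)\<^sup>2) \<le> energy w H y"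
proof -
  \<comment> \<open>Values outside \<open>verts H\<close> affect neither mass nor energy; cutting
    them off gives the finite support that the median needs.\<close>
  define y' where "y' u = (if u \<in> verts H then y u else 0)" for u
  have "finite {u. y' u \<noteq> 0}"
    using \<open>finite H\<close> by (auto simp: y'_def intro: finite_subset[of _ "verts H"])
  then obtain c where c: "2 * vol w H {u. c < y' u} \<le> vol w H UNIV"
    "2 * vol w H {u. y' u < c} \<le> vol w H UNIV"
    using weighted_median[of H w y'] w by blast
  define p where "p u = (if u \<in> verts H then max 0 (y u - c) else 0)" for u
  define q where "q u = (if u \<in> verts H then max 0 (c - y u) else 0)" for u
  have fst_snd: "fst e \<in> verts H" "snd e \<in> verts H" if "e \<in> H" for e
    using that by (auto simp: verts_def)
  have "vol w H {u. 0 < p u} \<le> vol w H {u. c < y' u}"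
    "vol w H {u. 0 < q u} \<le> vol w H {u. y' u < c}"
    by (auto intro!: vol_mono w simp: p_def q_def y'_def split: if_splits)
  then have P: "\<phi>\<^sup>2 / 2 * mass w H (\<lambda>u. (p u)\<^sup>2) \<le> energy w H p"
    and Q: "\<phi>\<^sup>2 / 2 * mass w H (\<lambda>u. (q u)\<^sup>2) \<le> energy w H q"
    using c \<open>finite H\<close>
    by (intro expander_mass_square_le assms; force simp: p_def q_def intro: finite_subset[of _ "verts H"])+
  have "mass w H (\<lambda>u. (y u - c)\<^sup>2) = mass w H (\<lambda>u. (p u)\<^sup>2 + (q u)\<^sup>2)"
    unfolding mass_def by (intro sum.cong) (auto simp: p_def q_def fst_snd max_def power2_eq_square algebra_simps)
  then have "\<phi>\<^sup>2 / 2 * mass w H (\<lambda>u. (y u - c)\<^sup>2) \<le> energy w H p + energy w H q"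
    using P Q by (simp add: mass_add algebra_simps)
  also have "\<dots> \<le> energy w H y"
    unfolding energy_def sum.distrib[symmetric]
  proof (intro sum_mono)
    fix e assume e: "e \<in> H"
    \<comment> \<open>If \<open>a\<close> and \<open>b\<close> lie on different sides of
      \<open>c\<close>, the right-hand side exceeds the left by twice the product of the distances
      to \<open>c\<close>; otherwise both sides agree.\<close>
    have *: "(max 0 (a - c) - max 0 (b - c))\<^sup>2 + (max 0 (c - a) - max 0 (c - b))\<^sup>2 \<le> (a - b)\<^sup>2"
      for a b :: real
    proof -
      have "0 \<le> (a - c) * (c - b)" if "b \<le> c" "c \<le> a" using that by simp
      moreover have "0 \<le> (b - c) * (c - a)" if "a \<le> c" "c \<le> b" using that by simp
      ultimately show ?thesis by (auto simp: max_def power2_eq_square algebra_simps)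
    qed
    show "w e * (p (fst e) - p (snd e))\<^sup>2 + w e * (q (fst e) - q (snd e))\<^sup>2
        \<le> w e * (y (fst e) - y (snd e))\<^sup>2"
      unfolding distrib_left[symmetric]
      using * w[OF e] by (intro mult_left_mono) (simp_all add: p_def q_def fst_snd[OF e])
  qed
  finally have "\<phi>\<^sup>2 / 2 * mass w H (\<lambda>u. (y u - c)\<^sup>2) \<le> energy w H y" .
  moreover have "\<phi>\<^sup>2 / 2 * mass w H (\<lambda>u. (y u - wmean w H y)\<^sup>2) \<le> \<phi>\<^sup>2 / 2 * mass w H (\<lambda>u. (y u - c)\<^sup>2)"
    using wmean_minimizes[of H w y c] assms by (intro mult_left_mono) auto
  ultimately show ?thesis by linarith
qed

section \<open>Expander decomposition\<close>

lemma vol_UNIV: "vol w H UNIV = 2 * sum w H"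
  by (simp add: vol_def mass_def sum_distrib_left mult.commute[of _ 2])

text \<open>A single edge already has volume \<open>2 * w e\<close>. This is the base case of both
  halving arguments below.\<close>

lemma empty_if_vol_small:
  assumes "finite E" "\<And>e. e \<in> E \<Longrightarrow> w0 \<le> w e" "0 < w0" "vol w E UNIV \<le> w0"
  shows "E = {}"
proof (rule ccontr)
  assume "E \<noteq> {}"
  then obtain e where e: "e \<in> E" by blast
  have "w e \<le> sum w E"
    using assms e by (intro member_le_sum) (auto intro: order_trans[of 0 w0])
  with assms(2)[OF e] assms(3,4) show False by (simp add: vol_UNIV)
qed

definition inner_edges :: "('v \<times> 'v) set \<Rightarrow> 'v set \<Rightarrow> ('v \<times> 'v) set" where
  "inner_edges E S = {e \<in> E. fst e \<in> S \<and> snd e \<in> S}"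

lemma vol_inner_edges_le:
  assumes "finite E" "\<And>e. e \<in> E \<Longrightarrow> 0 \<le> w e"
  shows "vol w (inner_edges E S) UNIV \<le> vol w E S"
proof -
  have "vol w (inner_edges E S) UNIV = vol w (inner_edges E S) S"
    unfolding vol_def mass_def by (intro sum.cong) (auto simp: inner_edges_def)
  also have "\<dots> \<le> vol w E S"
    unfolding vol_def mass_def using assms by (intro sum_mono2) (auto simp: inner_edges_def)
  finally show ?thesis .
qed

lemma sum_crossing_edges:
  assumes "finite E"
  shows "sum w (E - inner_edges E S - inner_edges E (- S)) = cut w E S"
proof -
  have "cut w E S = (\<Sum>e\<in>E. if e \<in> E - inner_edges E S - inner_edges E (- S) then w e else 0)"
    unfolding cut_def by (intro sum.cong) (auto simp: inner_edges_def indicator_def)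
  also have "\<dots> = sum w (E \<inter> (E - inner_edges E S - inner_edges E (- S)))"
    using assms by (rule sum.inter_restrict[symmetric])
  also have "E \<inter> (E - inner_edges E S - inner_edges E (- S)) = E - inner_edges E S - inner_edges E (- S)"
    by blast
  finally show ?thesis ..
qed

text \<open>As long as some part is not an expander, split it along a sparse cut. A vertex lies on the
  smaller side of at most \<open>l\<close> of the cuts, so it is charged for the cut edges at most \<open>l\<close> times.\<close>

lemma expander_partition:
  fixes E :: "('v \<times> 'v) set"
  assumes "finite E" "\<forall>e\<in>E. w0 \<le> w e" "0 < w0" "0 < \<phi>" "vol w E UNIV \<le> w0 * 2 ^ l"
  shows "\<exists>P. (\<forall>H\<in>P. H \<noteq> {} \<and> expander \<phi> w H) \<and> \<Union>P \<subseteq> E \<and>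
    (\<forall>H\<in>P. \<forall>H'\<in>P. H \<noteq> H' \<longrightarrow> verts H \<inter> verts H' = {}) \<and>
    sum w (E - \<Union>P) \<le> \<phi> * l * vol w E UNIV"
  using assms(1,2,5)
proof (induction "card E" arbitrary: E l rule: less_induct)
  case less
  have w: "0 \<le> w e" if "e \<in> E" for e using less.prems(2) assms(3) that by force
  show ?case
  proof (cases "E = {} \<or> expander \<phi> w E")
    case True
    show ?thesis
    proof (cases "E = {}")
      case True
      then show ?thesis using assms(4) by (intro exI[of _ "{}"]) (simp add: vol_UNIV)
    next
      case False
      then show ?thesis using True assms(4) vol_nonneg[of E w UNIV, OF w]
        by (intro exI[of _ "{E}"]) simp
    qed
  next
    case False
    then obtain S where S: "2 * vol w E S \<le> vol w E UNIV" "cut w E S < \<phi> * vol w E S"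
      by (auto simp: expander_def not_le)
    have "l \<noteq> 0" using False less.prems assms(3) empty_if_vol_small[of E w0 w] by auto
    then obtain k where l: "l = Suc k" by (cases l) auto
    define E1 where "E1 = inner_edges E S"
    define E2 where "E2 = inner_edges E (- S)"
    have sub: "E1 \<subseteq> E" "E2 \<subseteq> E" by (auto simp: E1_def E2_def inner_edges_def)
    have fin: "finite E1" "finite E2" using sub less.prems(1) by (auto intro: finite_subset)
    have v1: "vol w E1 UNIV \<le> vol w E S" "vol w E2 UNIV \<le> vol w E UNIV - vol w E S"
      using vol_inner_edges_le[of E w, OF less.prems(1) w]
      by (auto simp: E1_def E2_def simp flip: vol_compl)
    have "0 \<le> cut w E S" unfolding cut_def by (intro sum_nonneg mult_nonneg_nonneg w) auto
    with S(2) have "0 < \<phi> * vol w E S" by linarith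
    then have pos: "0 < vol w E S" using assms(4) by (simp add: zero_less_mult_iff)
    \<comment> \<open>Positive volume of \<open>S\<close> makes both sides lose edges: one side
      loses at least half of the volume, the other at least that of \<open>S\<close>. Hence the
      induction on the number of edges proceeds.\<close>
    have "E1 \<noteq> E" "E2 \<noteq> E" using v1 pos S(1) by auto
    then have card: "card E1 < card E" "card E2 < card E"
      using sub less.prems(1) by (auto intro!: psubset_card_mono)
    have w0: "\<forall>e\<in>E1. w0 \<le> w e" "\<forall>e\<in>E2. w0 \<le> w e" using less.prems(2) sub by auto
    \<comment> \<open>The smaller side has at most half of the volume and so uses up one level; the
      larger side keeps \<open>l\<close>.\<close>
    have vE1: "vol w E1 UNIV \<le> w0 * 2 ^ k" using v1(1) S(1) less.prems(3) l by simp
    obtain P1 where P1: "\<forall>H\<in>P1. H \<noteq> {} \<and> expander \<phi> w H" "\<Union>P1 \<subseteq> E1"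
      "\<forall>H\<in>P1. \<forall>H'\<in>P1. H \<noteq> H' \<longrightarrow> verts H \<inter> verts H' = {}"
      "sum w (E1 - \<Union>P1) \<le> \<phi> * k * vol w E1 UNIV"
      using less.hyps[OF card(1) fin(1) w0(1) vE1] by (elim exE conjE) rule
    have vE2: "vol w E2 UNIV \<le> w0 * 2 ^ l" using v1(2) pos less.prems(3) by linarith
    obtain P2 where P2: "\<forall>H\<in>P2. H \<noteq> {} \<and> expander \<phi> w H" "\<Union>P2 \<subseteq> E2"
      "\<forall>H\<in>P2. \<forall>H'\<in>P2. H \<noteq> H' \<longrightarrow> verts H \<inter> verts H' = {}"
      "sum w (E2 - \<Union>P2) \<le> \<phi> * l * vol w E2 UNIV"
      using less.hyps[OF card(2) fin(2) w0(2) vE2] by (elim exE conjE) rule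
    have "verts H \<subseteq> S" if "H \<in> P1" for H
      using that P1(2) by (auto simp: E1_def inner_edges_def verts_def)
    moreover have "verts H \<subseteq> - S" if "H \<in> P2" for H
      using that P2(2) by (fastforce simp: E2_def inner_edges_def verts_def)
    ultimately have "\<forall>H\<in>P1. \<forall>H'\<in>P2. verts H \<inter> verts H' = {}" by blast
    then have disj: "\<forall>H\<in>P1 \<union> P2. \<forall>H'\<in>P1 \<union> P2. H \<noteq> H' \<longrightarrow> verts H \<inter> verts H' = {}"
      using P1(3) P2(3) by (metis Un_iff inf_commute)
    have "sum w (E - \<Union>(P1 \<union> P2)) \<le> sum w ((E - E1 - E2) \<union> (E1 - \<Union>P1) \<union> (E2 - \<Union>P2))"
      using less.prems(1) fin sub w by (intro sum_mono2) auto
    also have "\<dots> = sum w (E - E1 - E2) + sum w (E1 - \<Union>P1) + sum w (E2 - \<Union>P2)"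
    proof -
      have "E1 \<inter> E2 = {}" by (auto simp: E1_def E2_def inner_edges_def)
      then show ?thesis
        using less.prems(1) fin by (subst sum.union_disjoint, auto)+
    qed
    \<comment> \<open>The volume of \<open>S\<close> pays once for the present cut and
      \<open>k\<close> times for later ones, which makes \<open>l\<close> in total.\<close>
    also have "\<dots> \<le> \<phi> * vol w E S + \<phi> * k * vol w E S + \<phi> * l * (vol w E UNIV - vol w E S)"
    proof (intro add_mono)
      show "sum w (E - E1 - E2) \<le> \<phi> * vol w E S"
        using sum_crossing_edges[OF less.prems(1), of w S] S(2) by (simp add: E1_def E2_def)
      have "\<phi> * k * vol w E1 UNIV \<le> \<phi> * k * vol w E S"
        using v1(1) assms(4) by (intro mult_left_mono) auto
      then show "sum w (E1 - \<Union>P1) \<le> \<phi> * k * vol w E S" using P1(4) by linarith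
      have "\<phi> * l * vol w E2 UNIV \<le> \<phi> * l * (vol w E UNIV - vol w E S)"
        using v1(2) assms(4) by (intro mult_left_mono) auto
      then show "sum w (E2 - \<Union>P2) \<le> \<phi> * l * (vol w E UNIV - vol w E S)" using P2(4) by linarith
    qed
    also have "\<dots> = \<phi> * l * vol w E UNIV" by (simp add: l algebra_simps)
    finally show ?thesis
      using P1 P2 disj sub by (intro exI[of _ "P1 \<union> P2"]) auto
  qed
qed

text \<open>Partition repeatedly the edges left over. With conductance
  \<open>1 / (4 * real L)\<close> their total weight is at most a quarter of the volume; as volume
  is twice the weight, the volume halves in each round, and \<open>l\<close> rounds use up all
  edges. The parts of one round have disjoint vertex sets and thus at most \<open>card V\<close>
  vertices together. \<open>L\<close> stays fixed while \<open>l\<close> falls, so all rounds share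
  one conductance.\<close>

lemma expander_decomposition:
  fixes E :: "('v \<times> 'v) set" and L :: nat
  assumes "finite E" "\<forall>e\<in>E. w0 \<le> w e" "0 < w0" "vol w E UNIV \<le> w0 * 2 ^ l" "l \<le> L"
    and "finite V" "verts E \<subseteq> V"
  shows "\<exists>P. (\<forall>H\<in>P. H \<noteq> {} \<and> expander (1 / (4 * real L)) w H) \<and> \<Union>P = E \<and> disjoint P \<and>
    (\<Sum>H\<in>P. card (verts H)) \<le> l * card V"
  using assms(1,2,4,5,7)
proof (induction l arbitrary: E)
  case 0
  have "E = {}" by (rule empty_if_vol_small[OF 0(1) _ assms(3)]) (use 0(2,3) in auto)
  then show ?case by (intro exI[of _ "{}"]) simp
next
  case (Suc l)
  have w: "0 \<le> w e" if "e \<in> E" for e using Suc.prems(2) assms(3) that by force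
  have L: "0 < 1 / (4 * real L)" using Suc.prems(4) by simp
  obtain P where P: "\<forall>H\<in>P. H \<noteq> {} \<and> expander (1 / (4 * real L)) w H" "\<Union>P \<subseteq> E"
    "\<forall>H\<in>P. \<forall>H'\<in>P. H \<noteq> H' \<longrightarrow> verts H \<inter> verts H' = {}"
    "sum w (E - \<Union>P) \<le> 1 / (4 * real L) * Suc l * vol w E UNIV"
    using expander_partition[OF Suc.prems(1,2) assms(3) L Suc.prems(3)] by (elim exE conjE) rule
  have fin: "finite P" "\<And>H. H \<in> P \<Longrightarrow> finite H"
    using finite_UnionD[OF finite_subset[OF P(2) Suc.prems(1)]] finite_subset[OF _ Suc.prems(1)] P(2)
    by (simp, blast)
  define R where "R = E - \<Union>P"
  have fR: "finite R" "\<forall>e\<in>R. w0 \<le> w e" using Suc.prems(1,2) by (auto simp: R_def)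
  have "vol w R UNIV \<le> vol w E UNIV / 2"
  proof -
    have "1 / (4 * real L) * Suc l \<le> 1 / 4" using Suc.prems(4) by (simp add: divide_simps)
    then have "1 / (4 * real L) * Suc l * vol w E UNIV \<le> 1 / 4 * vol w E UNIV"
      using vol_nonneg[of E w UNIV, OF w] by (intro mult_right_mono)
    then show ?thesis using P(4) by (simp add: vol_UNIV R_def)
  qed
  then have vR: "vol w R UNIV \<le> w0 * 2 ^ l" using Suc.prems(3) by simp
  have VR: "verts R \<subseteq> V" using Suc.prems(5) by (auto simp: verts_def R_def)
  obtain Q where Q: "\<forall>H\<in>Q. H \<noteq> {} \<and> expander (1 / (4 * real L)) w H" "\<Union>Q = R"
    "disjoint Q" "(\<Sum>H\<in>Q. card (verts H)) \<le> l * card V"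
    using Suc.IH[OF fR vR Suc_leD[OF Suc.prems(4)] VR] by (elim exE conjE) rule
  have finQ: "finite Q" using Q(2) Suc.prems(1) finite_UnionD[of Q] by (simp add: R_def)
  have "H \<inter> H' = {}" if "H \<in> P" "H' \<in> P" "H \<noteq> H'" for H H'
  proof (rule ccontr)
    assume "H \<inter> H' \<noteq> {}"
    then have "verts H \<inter> verts H' \<noteq> {}" by (auto simp: verts_def)
    then show False using that P(3) by blast
  qed
  then have "disjoint P" by (simp add: pairwise_def disjnt_def)
  moreover have PQ: "H \<inter> H' = {}" if "H \<in> P" "H' \<in> Q" for H H'
  proof -
    have "H' \<subseteq> E - \<Union>P" using that Q(2) by (auto simp: R_def)
    then show ?thesis using that by auto
  qed
  ultimately have "disjoint (P \<union> Q)"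
    using Q(3) by (intro disjoint_union) auto
  moreover have "(\<Sum>H\<in>P \<union> Q. card (verts H)) \<le> Suc l * card V"
  proof -
    have "(\<Sum>H\<in>P. card (verts H)) = card (\<Union>H\<in>P. verts H)"
      using fin P(3) by (intro card_UN_disjoint[symmetric]) auto
    also have "\<dots> \<le> card V"
      using P(2) Suc.prems(5) assms(6) by (intro card_mono) (auto simp: verts_def)
    finally have "(\<Sum>H\<in>P. card (verts H)) \<le> card V" .
    moreover have "(\<Sum>H\<in>P \<union> Q. card (verts H)) = (\<Sum>H\<in>P. card (verts H)) + (\<Sum>H\<in>Q. card (verts H))"
    proof (rule sum.union_disjoint)
      show "P \<inter> Q = {}" using Q(1) PQ by fastforce
    qed (use fin finQ in auto)
    ultimately show ?thesis using Q(4) by simp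
  qed
  ultimately show ?case
    using P(1,2) Q(1,2) by (intro exI[of _ "P \<union> Q"]) (simp add: R_def Un_absorb1 ball_Un)
qed

section \<open>Second moments of independent samples\<close>

text \<open>Conditioning on the first sample, the cross term is a multiple of the mean of the
  remaining sum. The first claim makes it vanish, so both claims are proved in one
  induction.\<close>

lemma expectation_replicate_pmf_sum_list:
  fixes g :: "'a \<Rightarrow> real"
  assumes "finite (set_pmf p)" "measure_pmf.expectation p g = 0"
  shows "measure_pmf.expectation (replicate_pmf T p) (\<lambda>l. sum_list (map g l)) = 0"
    and "measure_pmf.expectation (replicate_pmf T p) (\<lambda>l. (sum_list (map g l))\<^sup>2)
      = T * measure_pmf.expectation p (\<lambda>x. (g x)\<^sup>2)"
proof (induction T)
  case (Suc T)
  let ?R = "measure_pmf.expectation (replicate_pmf T p)"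
  let ?A = "set_pmf p"
  have int: "integrable (measure_pmf (replicate_pmf n p)) f" for n and f :: "'a list \<Rightarrow> real"
    using assms(1) by (intro integrable_measure_pmf_finite) (simp add: set_replicate_pmf finite_lists_length_eq lists_eq_set)
  have expand: "measure_pmf.expectation (replicate_pmf (Suc T) p) h
      = (\<Sum>a\<in>?A. pmf p a * ?R (\<lambda>l. h (a # l)))" for h :: "'a list \<Rightarrow> real"
  proof -
    have "measure_pmf.expectation (replicate_pmf (Suc T) p) h
        = (\<Sum>a\<in>?A. pmf p a *\<^sub>R measure_pmf.expectation (map_pmf ((#) a) (replicate_pmf T p)) h)"
      unfolding replicate_pmf.simps map_pmf_def
      using assms(1) by (intro pmf_expectation_bind)
        (auto simp: set_replicate_pmf lists_eq_set finite_lists_length_eq)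
    then show ?thesis by simp
  qed
  have E: "measure_pmf.expectation p f = (\<Sum>a\<in>?A. pmf p a * f a)" for f :: "'a \<Rightarrow> real"
    using assms(1) by (subst integral_measure_pmf[of ?A]) auto
  have one: "(\<Sum>a\<in>?A. pmf p a) = 1" using assms(1) by (intro sum_pmf_eq_1) auto
  {
    case 1
    show ?case
      unfolding expand using Suc.IH(1) assms(2) E[of g] by (simp add: int distrib_left sum.distrib)
  next
    case 2
    have "?R (\<lambda>l. (g a + sum_list (map g l))\<^sup>2) = (g a)\<^sup>2 + T * measure_pmf.expectation p (\<lambda>x. (g x)\<^sup>2)" for a
      using Suc.IH by (simp add: power2_sum int)
    then show ?case
      unfolding expand using one by (simp add: E[of "\<lambda>x. (g x)\<^sup>2"] distrib_left sum.distrib sum_distrib_left[symmetric] sum_distrib_right[symmetric] mult.left_commute distrib_right)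
  }
qed simp_all

text \<open>Chebyshev's inequality. The case \<open>a = 0\<close>, which arises when the energy
  vanishes, is treated apart because Markov's inequality would divide by zero; there
  \<open>X\<close> is 0 on the whole support.\<close>

lemma prob_abs_le_ge:
  fixes X :: "'a \<Rightarrow> real"
  assumes "finite (set_pmf p)" "measure_pmf.expectation p (\<lambda>s. (X s)\<^sup>2) \<le> \<delta> * a\<^sup>2" "0 \<le> a" "0 \<le> \<delta>"
  shows "1 - \<delta> \<le> measure_pmf.prob p {s. \<bar>X s\<bar> \<le> a}"
proof (cases "a = 0")
  case True
  have *: "(\<Sum>s\<in>set_pmf p. pmf p s * (X s)\<^sup>2) \<le> 0"
    using assms(1,2) True by (subst (asm) integral_measure_pmf[of "set_pmf p"]) auto
  have "\<forall>s\<in>set_pmf p. pmf p s * (X s)\<^sup>2 = 0"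
    using * assms(1) sum_nonneg_eq_0_iff[of "set_pmf p" "\<lambda>s. pmf p s * (X s)\<^sup>2"]
    by (simp add: sum_nonneg antisym)
  then have "set_pmf p \<subseteq> {s. \<bar>X s\<bar> \<le> a}" using True by (auto simp: set_pmf_iff)
  then have "measure_pmf.prob p {s. \<bar>X s\<bar> \<le> a} = 1"
    by (simp add: measure_pmf.prob_eq_1 AE_measure_pmf_iff subset_iff)
  then show ?thesis using assms(4) by simp
next
  case False
  with assms(3) have "0 < a\<^sup>2" by simp
  have "measure_pmf.prob p {s \<in> space p. a\<^sup>2 \<le> (X s)\<^sup>2} \<le> measure_pmf.expectation p (\<lambda>s. (X s)\<^sup>2) / a\<^sup>2"
    using \<open>0 < a\<^sup>2\<close> assms(1)
    by (intro integral_Markov_inequality_measure[where A="{}"]) (auto intro: integrable_measure_pmf_finite)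
  also have "\<dots> \<le> \<delta>" using assms(2) \<open>0 < a\<^sup>2\<close> by (simp add: field_simps)
  finally have "measure_pmf.prob p {s. a\<^sup>2 \<le> (X s)\<^sup>2} \<le> \<delta>" by simp
  moreover have "measure_pmf.prob p (- {s. a\<^sup>2 \<le> (X s)\<^sup>2}) = 1 - measure_pmf.prob p {s. a\<^sup>2 \<le> (X s)\<^sup>2}"
    using measure_pmf.prob_compl[of "{s. a\<^sup>2 \<le> (X s)\<^sup>2}" p] by (simp add: Compl_eq_Diff_UNIV)
  moreover have "measure_pmf.prob p (- {s. a\<^sup>2 \<le> (X s)\<^sup>2}) \<le> measure_pmf.prob p {s. \<bar>X s\<bar> \<le> a}"
    using assms(3) by (intro measure_pmf.finite_measure_mono) (auto simp: not_le power2_le_iff_abs_le[symmetric])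
  ultimately show ?thesis by simp
qed

lemma exists_pmf_on_finite:
  assumes "finite E" "\<And>e. e \<in> E \<Longrightarrow> 0 \<le> r e" "sum r E = 1"
  obtains p where "set_pmf p \<subseteq> E" "\<And>e. e \<in> E \<Longrightarrow> pmf p e = r e"
proof -
  define f where "f e = (if e \<in> E then r e else 0)" for e
  have f0: "0 \<le> f e" for e using assms(2) by (simp add: f_def)
  have "(\<integral>\<^sup>+ e. ennreal (f e) \<partial>count_space UNIV) = (\<Sum>e\<in>E. ennreal (f e))"
    using assms(1) by (intro nn_integral_count_space') (auto simp: f_def)
  also have "\<dots> = ennreal (\<Sum>e\<in>E. f e)" using f0 by (intro sum_ennreal) auto
  also have "(\<Sum>e\<in>E. f e) = 1" using assms(3) by (simp add: f_def)
  finally have "(\<integral>\<^sup>+ e. ennreal (f e) \<partial>count_space UNIV) = 1" by simp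
  then have "pmf (embed_pmf f) e = f e" for e using f0 by (intro pmf_embed_pmf)
  then show ?thesis
    using that[of "embed_pmf f"] unfolding f_def by (metis (no_types, lifting) pmf_eq_0_set_pmf subsetI)
qed

section \<open>Edge sampling in expanders\<close>

text \<open>Not normalized: over one piece with positive weights the values sum to the number of
  vertices, because the weight at each vertex is divided by its degree.\<close>

definition edge_prob :: "('v \<times> 'v \<Rightarrow> real) \<Rightarrow> ('v \<times> 'v) set \<Rightarrow> 'v \<times> 'v \<Rightarrow> real" where
  "edge_prob w H e = w e * (1 / wdeg w H (fst e) + 1 / wdeg w H (snd e))"

text \<open>With \<open>s\<close> samples per vertex the edge \<open>uv\<close> contributes \<open>w D\<^sub>u D\<^sub>v z\<^sub>u\<^sup>2 z\<^sub>v\<^sup>2 / (s (D\<^sub>u + D\<^sub>v))\<close> to the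
  variance. For a light edge this is at most \<open>(D\<^sub>u z\<^sub>u\<^sup>2) (D\<^sub>v z\<^sub>v\<^sup>2) / s\<^sup>2\<close>.\<close>

definition light :: "nat \<Rightarrow> ('v \<times> 'v \<Rightarrow> real) \<Rightarrow> ('v \<times> 'v) set \<Rightarrow> 'v \<times> 'v \<Rightarrow> bool" where
  "light s w H e \<longleftrightarrow> s * w e \<le> wdeg w H (fst e) + wdeg w H (snd e)"

text \<open>The importance-sampling quotient of \<open>w e * (z (fst e) * z (snd e))\<close> by
  \<open>edge_prob w H e\<close>. The weight of the edge cancels, which leaves only degrees.\<close>

definition sample_term :: "('v \<Rightarrow> real) \<Rightarrow> ('v \<Rightarrow> real) \<Rightarrow> 'v \<times> 'v \<Rightarrow> real" where
  "sample_term D z e = D (fst e) * D (snd e) / (D (fst e) + D (snd e)) * (z (fst e) * z (snd e))"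

lemma wdeg_pos:
  assumes "finite H" "\<forall>e\<in>H. 0 < w e" "u \<in> verts H"
  shows "0 < wdeg w H u"
proof -
  obtain e where e: "e \<in> H" "fst e = u \<or> snd e = u" using assms(3) by (auto simp: verts_def)
  have "0 < w e * (indicator {u} (fst e) + indicator {u} (snd e))"
    using e assms(2) by (auto simp: indicator_def)
  then show ?thesis
    unfolding wdeg_def vol_def mass_def using assms(1,2) e(1)
    by (intro sum_pos2[of _ e]) (auto intro!: mult_nonneg_nonneg less_imp_le[of 0 "w _"])
qed

lemma sum_edge_prob:
  assumes "finite H" "\<forall>e\<in>H. 0 < w e"
  shows "(\<Sum>e\<in>H. edge_prob w H e) = card (verts H)"
proof -
  have "(\<Sum>e\<in>H. edge_prob w H e) = mass w H (\<lambda>u. 1 / wdeg w H u)"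
    by (simp add: edge_prob_def mass_def)
  also have "\<dots> = (\<Sum>u\<in>verts H. 1)"
    unfolding mass_eq_sum_wdeg[OF assms(1)]
    using wdeg_pos[OF assms] by (intro sum.cong) (auto simp: less_imp_neq[symmetric])
  finally show ?thesis by simp
qed

lemma edge_prob_pos:
  assumes "finite H" "\<forall>e\<in>H. 0 < w e" "e \<in> H"
  shows "0 < edge_prob w H e"
  using wdeg_pos[OF assms(1,2), of "fst e"] wdeg_pos[OF assms(1,2), of "snd e"] assms
  by (auto simp: edge_prob_def verts_def intro!: mult_pos_pos add_pos_pos)

text \<open>A heavy edge has \<open>s * edge_prob w H e\<close> at least 1, and these numbers sum to
  \<open>s * card (verts H)\<close> over all edges.\<close>

lemma card_heavy_le:
  assumes "finite H" "\<forall>e\<in>H. 0 < w e"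
  shows "card {e \<in> H. \<not> light s w H e} \<le> s * card (verts H)"
proof -
  have "real (card {e \<in> H. \<not> light s w H e}) = (\<Sum>e\<in>{e \<in> H. \<not> light s w H e}. 1)" by simp
  also have "\<dots> \<le> (\<Sum>e\<in>{e \<in> H. \<not> light s w H e}. s * edge_prob w H e)"
  proof (rule sum_mono)
    fix e assume "e \<in> {e \<in> H. \<not> light s w H e}"
    then have e: "e \<in> H" "\<not> light s w H e" by auto
    define a b where "a = wdeg w H (fst e)" and "b = wdeg w H (snd e)"
    have ab: "0 < a" "0 < b"
      using e(1) wdeg_pos[OF assms] by (auto simp: a_def b_def verts_def)
    have "1 \<le> (a + b) * (1 / a + 1 / b)" using ab by (simp add: field_simps)
    also have "\<dots> \<le> (s * w e) * (1 / a + 1 / b)"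
      using e(2) ab by (intro mult_right_mono) (auto simp: light_def a_def b_def)
    finally show "1 \<le> s * edge_prob w H e" by (simp add: edge_prob_def a_def b_def mult.assoc)
  qed
  also have "\<dots> \<le> (\<Sum>e\<in>H. s * edge_prob w H e)"
    using assms(1) edge_prob_pos[OF assms] by (intro sum_mono2) (fastforce intro: mult_nonneg_nonneg less_imp_le)+
  also have "\<dots> = s * card (verts H)"
    using sum_edge_prob[OF assms] by (simp add: sum_distrib_left[symmetric])
  finally show ?thesis by (metis of_nat_le_iff of_nat_mult)
qed

lemma edge_prob_sample_term:
  assumes "finite H" "\<forall>e\<in>H. 0 < w e" "e \<in> H"
  shows "edge_prob w H e * sample_term (wdeg w H) z e = w e * (z (fst e) * z (snd e))"
proof -
  have "0 < wdeg w H (fst e)" "0 < wdeg w H (snd e)"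
    using assms wdeg_pos[OF assms(1,2)] by (auto simp: verts_def)
  then have "(1 / wdeg w H (fst e) + 1 / wdeg w H (snd e)) *
      (wdeg w H (fst e) * wdeg w H (snd e) / (wdeg w H (fst e) + wdeg w H (snd e))) = 1"
    by (simp add: add_frac_eq)
  moreover have "edge_prob w H e * sample_term (wdeg w H) z e = w e * (z (fst e) * z (snd e)) *
      ((1 / wdeg w H (fst e) + 1 / wdeg w H (snd e)) *
      (wdeg w H (fst e) * wdeg w H (snd e) / (wdeg w H (fst e) + wdeg w H (snd e))))"
    by (simp only: edge_prob_def sample_term_def mult_ac)
  ultimately show ?thesis by (simp only: mult_1_right)
qed

text \<open>Lightness bounds the term of an edge by \<open>h (fst e) * h (snd e) / s\<close>.
  Extending the sum to all pairs of vertices turns it into the square of the mass.\<close>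

lemma second_moment_le:
  assumes "finite H" "\<forall>e\<in>H. 0 < w e" "0 < s"
  shows "(\<Sum>e\<in>H. edge_prob w H e * (if light s w H e then sample_term (wdeg w H) z e else 0)\<^sup>2)
    \<le> (mass w H (\<lambda>u. (z u)\<^sup>2))\<^sup>2 / s"
proof -
  define h where "h u = wdeg w H u * (z u)\<^sup>2" for u
  have h0: "0 \<le> h u" if "u \<in> verts H" for u
    using wdeg_pos[OF assms(1,2) that] by (simp add: h_def)
  have sub: "H \<subseteq> verts H \<times> verts H" by (force simp: verts_def)
  have "(\<Sum>e\<in>H. edge_prob w H e * (if light s w H e then sample_term (wdeg w H) z e else 0)\<^sup>2)
      \<le> (\<Sum>e\<in>H. h (fst e) * h (snd e) / s)"
  proof (rule sum_mono)
    fix e assume e: "e \<in> H"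
    define a b where "a = wdeg w H (fst e)" and "b = wdeg w H (snd e)"
    have mem: "fst e \<in> verts H" "snd e \<in> verts H" using e by (auto simp: verts_def)
    have ab: "0 < a" "0 < b" using mem wdeg_pos[OF assms(1,2)] by (auto simp: a_def b_def)
    show "edge_prob w H e * (if light s w H e then sample_term (wdeg w H) z e else 0)\<^sup>2
        \<le> h (fst e) * h (snd e) / s"
    proof (cases "light s w H e")
      case True
      then have le: "w e / (a + b) \<le> 1 / s"
        using ab assms(3) by (simp add: light_def a_def b_def field_simps)
      have "edge_prob w H e * (sample_term (wdeg w H) z e)\<^sup>2
          = w e * (z (fst e) * z (snd e)) * sample_term (wdeg w H) z e"
        using edge_prob_sample_term[OF assms(1,2) e, of z] by (simp add: power2_eq_square)
      also have "\<dots> = w e / (a + b) * (h (fst e) * h (snd e))"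
        by (simp add: sample_term_def h_def a_def b_def power2_eq_square)
      also have "\<dots> \<le> 1 / s * (h (fst e) * h (snd e))"
        using le h0 mem by (intro mult_right_mono) auto
      finally show ?thesis using True by simp
    qed (use h0 mem in simp)
  qed
  also have "\<dots> \<le> (\<Sum>e\<in>verts H \<times> verts H. h (fst e) * h (snd e) / s)"
    using sub assms(1) h0 by (intro sum_mono2) auto
  also have "\<dots> = (mass w H (\<lambda>u. (z u)\<^sup>2))\<^sup>2 / s"
    unfolding mass_eq_sum_wdeg[OF assms(1)] h_def[symmetric]
    by (simp add: power2_eq_square sum_product sum.cartesian_product sum_divide_distrib case_prod_unfold)
  finally show ?thesis .
qed

text \<open>A sample carries its piece, on which degrees and centring depend. Heavy samples count as
  0, since heavy edges are stored exactly.\<close>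

definition sample_sum :: "nat \<Rightarrow> ('v \<times> 'v \<Rightarrow> real) \<Rightarrow> (('v \<times> 'v) set \<Rightarrow> 'v \<Rightarrow> real)
    \<Rightarrow> (('v \<times> 'v) set \<times> 'v \<times> 'v) list \<Rightarrow> real" where
  "sample_sum s w z l = (\<Sum>(H, e)\<leftarrow>l. if light s w H e then sample_term (wdeg w H) (z H) e else 0)"

text \<open>The total number of vertices normalizes the probabilities. Taking \<open>s\<close> times as many samples
  makes it cancel, so that the estimator needs neither this number nor the weights of the sampled edges.\<close>

lemma edge_sampling:
  fixes P :: "('v \<times> 'v) set set"
  assumes finP: "finite P" and P: "\<And>H. H \<in> P \<Longrightarrow> finite H \<and> H \<noteq> {}"
    and w: "\<And>H e. H \<in> P \<Longrightarrow> e \<in> H \<Longrightarrow> 0 < w e" and s: "0 < s"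
  obtains p where "finite (set_pmf p)"
    "\<And>l. l \<in> set_pmf p \<Longrightarrow> set l \<subseteq> (SIGMA H:P. H) \<and> length l = (\<Sum>H\<in>P. card (verts H)) * s"
    "\<And>z. measure_pmf.expectation p (\<lambda>l. (sample_sum s w z l / s
        - (\<Sum>H\<in>P. \<Sum>e\<in>{e \<in> H. light s w H e}. w e * (z H (fst e) * z H (snd e))))\<^sup>2)
      \<le> (\<Sum>H\<in>P. (mass w H (\<lambda>u. (z H u)\<^sup>2))\<^sup>2) / s\<^sup>2"
proof (cases "P = {}")
  case True
  show ?thesis
    by (rule that[of "return_pmf []"]) (auto simp: True sample_sum_def)
next
  case False
  define M where "M = (\<Sum>H\<in>P. card (verts H))"
  define I where "I = (SIGMA H:P. H)"
  have fin_I: "finite I" using finP P by (auto simp: I_def)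
  obtain H0 where H0: "H0 \<in> P" using False by blast
  have "0 < card (verts H0)" using P[OF H0] by (auto simp: card_gt_0_iff verts_def)
  also have "\<dots> \<le> M" unfolding M_def using finP H0 by (intro member_le_sum) auto
  finally have M: "0 < M" .
  have sum_I: "(\<Sum>x\<in>I. F (fst x) (snd x)) = (\<Sum>H\<in>P. \<Sum>e\<in>H. F H e)" for F :: "_ \<Rightarrow> _ \<Rightarrow> real"
    unfolding I_def using finP P by (subst sum.Sigma) (auto simp: case_prod_unfold)
  have pos: "0 < edge_prob w H e" if "H \<in> P" "e \<in> H" for H e
    using edge_prob_pos[of H w e] P w that by blast
  have "(\<Sum>x\<in>I. edge_prob w (fst x) (snd x) / M) = (\<Sum>H\<in>P. card (verts H)) / M"
    using P w by (subst sum_I[of "\<lambda>H e. edge_prob w H e / M"])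
      (simp add: sum_divide_distrib[symmetric] sum_edge_prob)
  also have "\<dots> = 1" using M unfolding M_def[symmetric] by simp
  finally have one: "(\<Sum>x\<in>I. edge_prob w (fst x) (snd x) / M) = 1" .
  have nn: "0 \<le> edge_prob w (fst x) (snd x) / M" if "x \<in> I" for x
    using pos[of "fst x" "snd x"] that by (auto simp: I_def)
  obtain q where q: "set_pmf q \<subseteq> I"
    "\<And>x. x \<in> I \<Longrightarrow> pmf q x = edge_prob w (fst x) (snd x) / M"
    using exists_pmf_on_finite[of I "\<lambda>x. edge_prob w (fst x) (snd x) / M"] fin_I one nn by blast
  have fin_q: "finite (set_pmf q)" using q(1) fin_I by (rule finite_subset)
  have Eq: "measure_pmf.expectation q f = (\<Sum>x\<in>I. edge_prob w (fst x) (snd x) * f x) / M"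
    for f :: "_ \<Rightarrow> real"
    using q fin_I by (subst integral_measure_pmf[of I]) (auto simp: sum_divide_distrib intro!: sum.cong)
  show ?thesis
  proof (rule that[of "replicate_pmf (M * s) q"])
    show "finite (set_pmf (replicate_pmf (M * s) q))"
      using fin_q by (simp add: set_replicate_pmf lists_eq_set finite_lists_length_eq)
    show "set l \<subseteq> (SIGMA H:P. H) \<and> length l = (\<Sum>H\<in>P. card (verts H)) * s"
      if "l \<in> set_pmf (replicate_pmf (M * s) q)" for l
      using that q(1) by (auto simp: set_replicate_pmf M_def I_def)
    fix z :: "('v \<times> 'v) set \<Rightarrow> 'v \<Rightarrow> real"
    define G where "G x = (if light s w (fst x) (snd x)
      then sample_term (wdeg w (fst x)) (z (fst x)) (snd x) else 0)" for x
    define \<mu> where "\<mu> = measure_pmf.expectation q G"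
    have int: "integrable (measure_pmf q) f" for f :: "_ \<Rightarrow> real"
      using fin_q by (rule integrable_measure_pmf_finite)
    have eq: "edge_prob w H e * (if light s w H e then sample_term (wdeg w H) (z H) e else 0)
        = (if light s w H e then w e * (z H (fst e) * z H (snd e)) else 0)" if "H \<in> P" "e \<in> H" for H e
      using edge_prob_sample_term[of H w e "z H"] P w that by simp
    have "(\<Sum>x\<in>I. edge_prob w (fst x) (snd x) * G x)
        = (\<Sum>H\<in>P. \<Sum>e\<in>H. if light s w H e then w e * (z H (fst e) * z H (snd e)) else 0)"
      unfolding G_def
      using P w by (subst sum_I[of "\<lambda>H e. edge_prob w H e * (if light s w H e
        then sample_term (wdeg w H) (z H) e else 0)"])
        (simp add: eq cong: sum.cong)
    also have "\<dots> = (\<Sum>H\<in>P. \<Sum>e\<in>{e \<in> H. light s w H e}. w e * (z H (fst e) * z H (snd e)))"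
      using P by (intro sum.cong refl sum.inter_filter[symmetric]) auto
    finally have mean: "M * \<mu> = (\<Sum>H\<in>P. \<Sum>e\<in>{e \<in> H. light s w H e}. w e * (z H (fst e) * z H (snd e)))"
      using M by (simp add: \<mu>_def Eq)
    \<comment> \<open>Division by \<open>s\<close> instead of by the number \<open>M * s\<close> of
      samples leaves a factor \<open>M\<close>, which undoes the normalization of
      \<open>q\<close>.\<close>
    have sum_list_eq: "sum_list (map (\<lambda>x. (G x - \<mu>) / s) l) = sample_sum s w z l / s - M * \<mu>"
      if len: "length l = M * s" for l
    proof -
      have "sum_list (map (\<lambda>x. (G x - \<mu>) / s) l) = (sum_list (map G l) - length l * \<mu>) / s"
        using s by (induction l) (simp_all add: field_simps)
      also have "sum_list (map G l) = sample_sum s w z l"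
        by (simp add: sample_sum_def G_def[abs_def] case_prod_unfold)
      finally show ?thesis using len s by (simp add: diff_divide_distrib)
    qed
    have "measure_pmf.expectation (replicate_pmf (M * s) q) (\<lambda>l. (sample_sum s w z l / s - M * \<mu>)\<^sup>2)
        = measure_pmf.expectation (replicate_pmf (M * s) q) (\<lambda>l. (sum_list (map (\<lambda>x. (G x - \<mu>) / s) l))\<^sup>2)"
      by (intro integral_cong_AE) (auto simp: AE_measure_pmf_iff set_replicate_pmf sum_list_eq)
    also have "\<dots> = real (M * s) * measure_pmf.expectation q (\<lambda>x. ((G x - \<mu>) / s)\<^sup>2)"
      by (intro expectation_replicate_pmf_sum_list fin_q) (simp add: int \<mu>_def[symmetric])
    also have "\<dots> = M / s * measure_pmf.expectation q (\<lambda>x. (G x - \<mu>)\<^sup>2)"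
      using s by (simp add: power_divide power2_eq_square)
    also have "\<dots> \<le> M / s * measure_pmf.expectation q (\<lambda>x. (G x)\<^sup>2)"
    proof (rule mult_left_mono)
      have "measure_pmf.expectation q (\<lambda>x. (G x - \<mu>)\<^sup>2)
          = measure_pmf.expectation q (\<lambda>x. (G x)\<^sup>2) - \<mu>\<^sup>2"
        unfolding \<mu>_def by (rule measure_pmf.variance_eq[OF int int])
      then show "measure_pmf.expectation q (\<lambda>x. (G x - \<mu>)\<^sup>2) \<le> measure_pmf.expectation q (\<lambda>x. (G x)\<^sup>2)"
        by simp
    qed simp
    \<comment> \<open>The factor \<open>M\<close> cancels against the normalization of
      \<open>q\<close>.\<close>
    also have "\<dots> = (\<Sum>H\<in>P. \<Sum>e\<in>H. edge_prob w H e * (if light s w H e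
        then sample_term (wdeg w H) (z H) e else 0)\<^sup>2) / s"
      using M unfolding Eq G_def
      by (subst sum_I[of "\<lambda>H e. edge_prob w H e * (if light s w H e
        then sample_term (wdeg w H) (z H) e else 0)\<^sup>2"]) simp
    also have "\<dots> \<le> (\<Sum>H\<in>P. (mass w H (\<lambda>u. (z H u)\<^sup>2))\<^sup>2 / s) / s"
      using P w s by (intro divide_right_mono sum_mono second_moment_le) auto
    also have "\<dots> = (\<Sum>H\<in>P. (mass w H (\<lambda>u. (z H u)\<^sup>2))\<^sup>2) / s\<^sup>2"
      by (simp add: sum_divide_distrib[symmetric] power2_eq_square)
    finally show "measure_pmf.expectation (replicate_pmf (M * s) q) (\<lambda>l. (sample_sum s w z l / s
        - (\<Sum>H\<in>P. \<Sum>e\<in>{e \<in> H. light s w H e}. w e * (z H (fst e) * z H (snd e))))\<^sup>2)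
      \<le> (\<Sum>H\<in>P. (mass w H (\<lambda>u. (z H u)\<^sup>2))\<^sup>2) / s\<^sup>2"
      unfolding mean .
  qed
qed

text \<open>By the spectral gap the root mean square error is at most
  \<open>2 / (s * \<phi>\<^sup>2)\<close> times the total energy. The constant 40 makes this a tenth
  of the tolerance \<epsilon> / 2, so Chebyshev's inequality gives failure probability 1 / 100. The
  distribution is chosen before \<open>y\<close>.\<close>

lemma expander_edge_sampling:
  fixes P :: "('v \<times> 'v) set set"
  assumes finP: "finite P" and "\<forall>H\<in>P. finite H \<and> H \<noteq> {} \<and> expander \<phi> w H \<and> (\<forall>e\<in>H. 0 < w e)"
    and s: "40 / (\<epsilon> * \<phi>\<^sup>2) \<le> s" and "0 < \<phi>" "0 < \<epsilon>"
  shows "\<exists>p. (\<forall>l\<in>set_pmf p. set l \<subseteq> (SIGMA H:P. H) \<and> length l = (\<Sum>H\<in>P. card (verts H)) * s) \<and>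
    (\<forall>y. 1 - 1 / 100 \<le> measure_pmf.prob p {l. \<bar>sample_sum s w (\<lambda>H u. y u - wmean w H y) l / s
        - (\<Sum>H\<in>P. \<Sum>e\<in>{e \<in> H. light s w H e}.
            w e * ((y (fst e) - wmean w H y) * (y (snd e) - wmean w H y)))\<bar>
      \<le> \<epsilon> / 2 * (\<Sum>H\<in>P. energy w H y)})"
proof -
  have P: "\<And>H. H \<in> P \<Longrightarrow> finite H \<and> H \<noteq> {}" and exp: "\<And>H. H \<in> P \<Longrightarrow> expander \<phi> w H"
    and w: "\<And>H e. H \<in> P \<Longrightarrow> e \<in> H \<Longrightarrow> 0 < w e"
    using assms(2) by blast+
  have "0 < 40 / (\<epsilon> * \<phi>\<^sup>2)" using assms(4,5) by simp
  then have s0: "0 < s" using s by (cases s) auto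
  obtain p where p: "finite (set_pmf p)"
    "\<And>l. l \<in> set_pmf p \<Longrightarrow> set l \<subseteq> (SIGMA H:P. H) \<and> length l = (\<Sum>H\<in>P. card (verts H)) * s"
    "\<And>z. measure_pmf.expectation p (\<lambda>l. (sample_sum s w z l / s
        - (\<Sum>H\<in>P. \<Sum>e\<in>{e \<in> H. light s w H e}. w e * (z H (fst e) * z H (snd e))))\<^sup>2)
      \<le> (\<Sum>H\<in>P. (mass w H (\<lambda>u. (z H u)\<^sup>2))\<^sup>2) / s\<^sup>2"
    using edge_sampling[of P w s] finP P w s0 by blast
  show ?thesis
  proof (intro exI[of _ p] conjI ballI allI p(2)[THEN conjunct1] p(2)[THEN conjunct2])
    fix y :: "'v \<Rightarrow> real"
    define B where "B = (\<Sum>H\<in>P. energy w H y)"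
    define m where "m H = mass w H (\<lambda>u. (y u - wmean w H y)\<^sup>2)" for H
    have w': "0 \<le> w e" if "H \<in> P" "e \<in> H" for H e using w[OF that] by simp
    have m0: "0 \<le> m H" if "H \<in> P" for H using w' that by (auto simp: m_def intro!: mass_nonneg)
    have e0: "0 \<le> energy w H y" if "H \<in> P" for H
      using w' that by (auto simp: energy_def intro!: sum_nonneg)
    have m_le: "m H \<le> 2 / \<phi>\<^sup>2 * energy w H y" if "H \<in> P" for H
      using expander_spectral_gap[of H w \<phi> y] w' exp[OF that] P[OF that] that assms(4)
      by (simp add: m_def field_simps)
    have "(\<Sum>H\<in>P. (m H)\<^sup>2) \<le> (\<Sum>H\<in>P. m H)\<^sup>2"
    proof -
      have "(\<Sum>H\<in>P. (m H)\<^sup>2) \<le> (\<Sum>H\<in>P. m H * (\<Sum>H\<in>P. m H))"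
        unfolding power2_eq_square
        using finP m0 by (intro sum_mono mult_left_mono member_le_sum) auto
      then show ?thesis by (simp add: sum_distrib_right[symmetric] power2_eq_square)
    qed
    also have "\<dots> \<le> (2 / \<phi>\<^sup>2 * B)\<^sup>2"
      using m_le m0 by (intro power_mono) (auto simp: B_def sum_distrib_left intro!: sum_mono sum_nonneg)
    finally have "(\<Sum>H\<in>P. (m H)\<^sup>2) / s\<^sup>2 \<le> (2 / \<phi>\<^sup>2 * B)\<^sup>2 / s\<^sup>2"
      by (rule divide_right_mono) simp
    also have "\<dots> = (2 / (s * \<phi>\<^sup>2) * B)\<^sup>2" by (simp add: power_mult_distrib power_divide)
    also have "\<dots> \<le> (\<epsilon> / 20 * B)\<^sup>2"
    proof (intro power_mono mult_right_mono)
      have "40 \<le> s * (\<epsilon> * \<phi>\<^sup>2)" using s assms(4,5) by (simp add: field_simps)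
      then show "2 / (s * \<phi>\<^sup>2) \<le> \<epsilon> / 20" using s0 assms(4) by (simp add: field_simps)
    qed (auto simp: B_def intro!: mult_nonneg_nonneg divide_nonneg_nonneg sum_nonneg e0)
    also have "\<dots> = 1 / 100 * (\<epsilon> / 2 * B)\<^sup>2" by (simp add: power2_eq_square)
    finally have "(\<Sum>H\<in>P. (m H)\<^sup>2) / s\<^sup>2 \<le> 1 / 100 * (\<epsilon> / 2 * B)\<^sup>2" .
    then show "1 - 1 / 100 \<le> measure_pmf.prob p {l. \<bar>sample_sum s w (\<lambda>H u. y u - wmean w H y) l / s
        - (\<Sum>H\<in>P. \<Sum>e\<in>{e \<in> H. light s w H e}.
            w e * ((y (fst e) - wmean w H y) * (y (snd e) - wmean w H y)))\<bar>
      \<le> \<epsilon> / 2 * (\<Sum>H\<in>P. energy w H y)}"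
      using assms(5)
      by (intro prob_abs_le_ge p(1) order_trans[OF p(3)])
        (auto simp: m_def B_def intro!: mult_nonneg_nonneg sum_nonneg e0)
  qed
qed

section \<open>Encoding into machine words\<close>

text \<open>Stronger than injectivity: a code word can be split off from any continuation, which is
  what makes concatenations decodable.\<close>

definition prefix_free :: "('a \<Rightarrow> 'b list) \<Rightarrow> bool" where
  "prefix_free c \<longleftrightarrow> (\<forall>x y r t. c x @ r = c y @ t \<longrightarrow> x = y \<and> r = t)"

lemma prefix_freeD: "prefix_free c \<Longrightarrow> c x @ r = c y @ t \<Longrightarrow> x = y \<and> r = t"
  by (simp add: prefix_free_def)

lemma prefix_free_imp_inj: "prefix_free c \<Longrightarrow> inj c"
  by (metis injI prefix_free_def)

definition enc_bool :: "bool \<Rightarrow> mword list" where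
  "enc_bool b = [Index (of_bool b)]"

definition enc_prod :: "('a \<Rightarrow> 'c list) \<Rightarrow> ('b \<Rightarrow> 'c list) \<Rightarrow> 'a \<times> 'b \<Rightarrow> 'c list" where
  "enc_prod c d x = c (fst x) @ d (snd x)"

definition enc_list :: "('a \<Rightarrow> mword list) \<Rightarrow> 'a list \<Rightarrow> mword list" where
  "enc_list c xs = concat (map (\<lambda>x. Index 0 # c x) xs) @ [Index 1]"

lemma prefix_free_nat: "prefix_free (\<lambda>i. [Index i])"
  and prefix_free_real: "prefix_free (\<lambda>v. [Value v])"
  and prefix_free_unit: "prefix_free (\<lambda>_ :: unit. [])"
  and prefix_free_bool: "prefix_free enc_bool"
  by (auto simp: prefix_free_def enc_bool_def of_bool_def split: if_splits)

lemma prefix_free_prod: "prefix_free c \<Longrightarrow> prefix_free d \<Longrightarrow> prefix_free (enc_prod c d)"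
  unfolding prefix_free_def enc_prod_def append_assoc by (metis prod.collapse)

lemma prefix_free_list:
  assumes "prefix_free c"
  shows "prefix_free (enc_list c)"
proof -
  have "xs = ys \<and> r = t" if "enc_list c xs @ r = enc_list c ys @ t" for xs ys r t
    using that
  proof (induction xs arbitrary: ys)
    case Nil
    then show ?case by (cases ys) (auto simp: enc_list_def)
  next
    case (Cons x xs)
    then obtain y ys' where ys: "ys = y # ys'" by (cases ys) (auto simp: enc_list_def)
    then have "c x @ (enc_list c xs @ r) = c y @ (enc_list c ys' @ t)"
      using Cons.prems by (simp add: enc_list_def)
    then have "x = y" "enc_list c xs @ r = enc_list c ys' @ t"
      using prefix_freeD[OF assms] by blast+
    then show ?case using Cons.IH ys by blast
  qed
  then show ?thesis by (simp add: prefix_free_def)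
qed

lemma length_enc_list: "length (enc_list c xs) = 1 + (\<Sum>x\<leftarrow>xs. 1 + length (c x))"
  by (induction xs) (auto simp: enc_list_def)

lemma set_enc_list: "set (enc_list c xs) \<subseteq> {Index 0, Index 1} \<union> (\<Union>x\<in>set xs. set (c x))"
  by (auto simp: enc_list_def)

type_synonym vertex = "nat \<times> bool"

text \<open>The record of a piece: its vertices, each with the sum of the positive and the sum of the
  negative entries on the incident edges (their difference is the degree), its heavy edges with
  their entries, and its sampled edges.\<close>

type_synonym piece =
  "(vertex \<times> real \<times> real) list \<times> ((vertex \<times> vertex) \<times> real) list \<times> (vertex \<times> vertex) list"

text \<open>The diagonal of the matrix, the number \<open>s\<close> in unary, and the pieces.\<close>

type_synonym sketch_data = "real list \<times> unit list \<times> piece list"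

definition enc_vertex :: "vertex \<Rightarrow> mword list" where
  "enc_vertex = enc_prod (\<lambda>i. [Index i]) enc_bool"

definition enc_piece :: "piece \<Rightarrow> mword list" where
  "enc_piece = enc_prod (enc_list (enc_prod enc_vertex (enc_prod (\<lambda>v. [Value v]) (\<lambda>v. [Value v]))))
    (enc_prod (enc_list (enc_prod (enc_prod enc_vertex enc_vertex) (\<lambda>v. [Value v])))
      (enc_list (enc_prod enc_vertex enc_vertex)))"

definition enc_sketch :: "sketch_data \<Rightarrow> mword list" where
  "enc_sketch = enc_prod (enc_list (\<lambda>v. [Value v])) (enc_prod (enc_list (\<lambda>_. [])) (enc_list enc_piece))"

lemma inj_enc_sketch: "inj enc_sketch"
  unfolding enc_sketch_def enc_piece_def enc_vertex_def
  by (intro prefix_free_imp_inj prefix_free_prod prefix_free_list prefix_free_nat prefix_free_real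
      prefix_free_unit prefix_free_bool)

lemma length_enc_vertex: "length (enc_vertex v) = 2"
  by (simp add: enc_vertex_def enc_prod_def enc_bool_def)

lemma length_enc_piece:
  "length (enc_piece (rs, hs, ls)) = 3 + 5 * length rs + 6 * length hs + 5 * length ls"
  by (simp add: enc_piece_def length_enc_list enc_prod_def length_enc_vertex sum_list_triv)

section \<open>The estimator on decoded data\<close>

definition degree_of :: "(vertex \<times> real \<times> real) list \<Rightarrow> vertex \<Rightarrow> real" where
  "degree_of rs u = (case map_of rs u of None \<Rightarrow> 0 | Some (p, m) \<Rightarrow> p - m)"

text \<open>The energy is invariant under the shift to \<open>z\<close>, so the degree-weighted sum
  of \<open>z\<^sup>2\<close> minus that of \<open>y\<^sup>2\<close>, minus twice the cross terms of
  \<open>z\<close>, equals minus twice the cross terms of \<open>y\<close>. The cross terms of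
  \<open>z\<close> are exact on heavy edges and sampled on light ones.\<close>

definition estimate_piece :: "nat \<Rightarrow> (vertex \<Rightarrow> real) \<Rightarrow> piece \<Rightarrow> real" where
  "estimate_piece s y = (\<lambda>(rs, hs, ls).
    let D = degree_of rs; us = map fst rs;
        m = (\<Sum>u\<leftarrow>us. D u * y u) / (\<Sum>u\<leftarrow>us. D u);
        z = (\<lambda>u. y u - m)
    in (\<Sum>u\<leftarrow>us. D u * (z u)\<^sup>2) - (\<Sum>u\<leftarrow>us. D u * (y u)\<^sup>2)
      - 2 * (\<Sum>(e, a)\<leftarrow>hs. \<bar>a\<bar> * (z (fst e) * z (snd e)))
      - 2 * ((\<Sum>e\<leftarrow>ls. sample_term D z e) / s))"

definition lift_vec :: "real vec \<Rightarrow> vertex \<Rightarrow> real" where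
  "lift_vec x u = (if snd u then x $ fst u else - x $ fst u)"

definition estimate_data :: "sketch_data \<Rightarrow> real vec \<Rightarrow> real" where
  "estimate_data = (\<lambda>(ds, us, ps) x.
    (\<Sum>i<length ds. ds ! i * (x $ i)\<^sup>2) + (\<Sum>pc\<leftarrow>ps. estimate_piece (length us) (lift_vec x) pc) / 2)"

definition estimate_words :: "mword list \<Rightarrow> real vec \<Rightarrow> real" where
  "estimate_words s x = estimate_data (inv_into UNIV enc_sketch s) x"

section \<open>The signed double cover of an SDD matrix\<close>

definition entry :: "real mat \<Rightarrow> vertex \<times> vertex \<Rightarrow> real" where
  "entry A e = A $$ (fst (fst e), fst (snd e))"

definition weight :: "real mat \<Rightarrow> vertex \<times> vertex \<Rightarrow> real" where
  "weight A e = \<bar>entry A e\<bar>"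

text \<open>An index \<open>i\<close> has the copies \<open>(i, True)\<close> and \<open>(i, False)\<close>, which carry the values \<open>x\<^sub>i\<close> and \<open>-x\<^sub>i\<close>. A
  negative entry joins copies of equal sign, a positive one copies of opposite sign.\<close>

definition cover_edge :: "real mat \<Rightarrow> nat \<times> nat \<Rightarrow> bool \<Rightarrow> vertex \<times> vertex" where
  "cover_edge A ij b = ((fst ij, b), (snd ij, b \<noteq> (0 < A $$ ij)))"

definition upper_support :: "real mat \<Rightarrow> (nat \<times> nat) set" where
  "upper_support A = {(i, j). i < j \<and> j < dim_row A \<and> A $$ (i, j) \<noteq> 0}"

definition cover_edges :: "real mat \<Rightarrow> (vertex \<times> vertex) set" where
  "cover_edges A = (\<lambda>(ij, b). cover_edge A ij b) ` (upper_support A \<times> UNIV)"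

lemma finite_upper_support [simp]: "finite (upper_support A)"
  by (rule finite_subset[of _ "{..<dim_row A} \<times> {..<dim_row A}"]) (auto simp: upper_support_def)

lemma finite_cover_edges [simp]: "finite (cover_edges A)"
  by (simp add: cover_edges_def)

lemma sum_cover_edges:
  fixes F :: "vertex \<times> vertex \<Rightarrow> real"
  shows "(\<Sum>e\<in>cover_edges A. F e) = (\<Sum>ij\<in>upper_support A. F (cover_edge A ij True) + F (cover_edge A ij False))"
proof -
  have "(\<Sum>e\<in>cover_edges A. F e) = (\<Sum>(ij, b)\<in>upper_support A \<times> UNIV. F (cover_edge A ij b))"
    unfolding cover_edges_def
    by (subst sum.reindex) (auto simp: inj_on_def cover_edge_def case_prod_unfold)
  also have "\<dots> = (\<Sum>ij\<in>upper_support A. \<Sum>b\<in>UNIV. F (cover_edge A ij b))"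
    by (rule sum.cartesian_product[symmetric])
  finally show ?thesis by (simp add: UNIV_bool add.commute)
qed

lemma sum_upper_support:
  fixes F :: "nat \<Rightarrow> nat \<Rightarrow> real"
  assumes "\<And>i j. A $$ (i, j) = 0 \<Longrightarrow> F i j = 0"
  shows "(\<Sum>ij\<in>upper_support A. F (fst ij) (snd ij)) = (\<Sum>i<dim_row A. \<Sum>j<dim_row A. if i < j then F i j else 0)"
proof -
  have "(\<Sum>i<dim_row A. \<Sum>j<dim_row A. if i < j then F i j else 0)
      = (\<Sum>ij\<in>{..<dim_row A} \<times> {..<dim_row A}. if fst ij < snd ij then F (fst ij) (snd ij) else 0)"
    by (simp add: sum.cartesian_product case_prod_unfold)
  also have "\<dots> = (\<Sum>ij\<in>upper_support A. F (fst ij) (snd ij))"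
    using assms by (intro sum.mono_neutral_cong_right) (auto simp: upper_support_def)
  finally show ?thesis ..
qed

lemma sum_symmetric_split:
  fixes F :: "nat \<Rightarrow> nat \<Rightarrow> real"
  shows "(\<Sum>i<n. \<Sum>j<n. F i j) = (\<Sum>i<n. F i i) + (\<Sum>i<n. \<Sum>j<n. if i < j then F i j + F j i else 0)"
proof -
  have "(\<Sum>i<n. \<Sum>j<n. F i j) = (\<Sum>i<n. \<Sum>j<n. (if i = j then F i j else 0)
      + (if i < j then F i j else 0) + (if j < i then F i j else 0))"
    by (intro sum.cong) auto
  also have "\<dots> = (\<Sum>i<n. F i i) + (\<Sum>i<n. \<Sum>j<n. if i < j then F i j else 0)
      + (\<Sum>i<n. \<Sum>j<n. if j < i then F i j else 0)"
    by (simp add: sum.distrib sum.delta)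
  also have "(\<Sum>i<n. \<Sum>j<n. if j < i then F i j else 0) = (\<Sum>i<n. \<Sum>j<n. if i < j then F j i else 0)"
    by (rule sum.swap)
  finally show ?thesis
    by (simp add: sum.distrib[symmetric] add.assoc if_distrib cong: if_cong)
qed

lemma quad_form_sum:
  assumes "A \<in> carrier_mat n n" "x \<in> carrier_vec n"
  shows "quad_form A x = (\<Sum>i<n. \<Sum>j<n. A $$ (i, j) * (x $ i * x $ j))"
  using assms
  by (simp add: quad_form_def scalar_prod_def mult_mat_vec_def atLeast0LessThan sum_distrib_left mult_ac)

lemma sdd_sym: "sdd A \<Longrightarrow> i < dim_row A \<Longrightarrow> j < dim_row A \<Longrightarrow> A $$ (i, j) = A $$ (j, i)"
  unfolding sdd_def by (metis index_transpose_mat(1) square_mat.simps)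

text \<open>The lifted values at the ends of a cover edge multiply to \<open>x $ i * x $ j\<close>
  with the sign opposite to that of the entry. The two copies of an entry above the diagonal
  therefore account for it and its mirror image.\<close>

lemma quad_form_eq_cover:
  assumes A: "A \<in> carrier_mat n n" "sdd A" and x: "x \<in> carrier_vec n"
  shows "quad_form A x = (\<Sum>i<n. A $$ (i, i) * (x $ i)\<^sup>2)
    - (\<Sum>e\<in>cover_edges A. weight A e * (lift_vec x (fst e) * lift_vec x (snd e)))"
proof -
  have n: "dim_row A = n" using A by auto
  have "(\<Sum>e\<in>cover_edges A. weight A e * (lift_vec x (fst e) * lift_vec x (snd e)))
      = (\<Sum>ij\<in>upper_support A. - 2 * (A $$ (fst ij, snd ij) * (x $ fst ij * x $ snd ij)))"
    unfolding sum_cover_edges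
    by (intro sum.cong) (auto simp: cover_edge_def weight_def entry_def lift_vec_def)
  also have "\<dots> = (\<Sum>i<n. \<Sum>j<n. if i < j then - 2 * (A $$ (i, j) * (x $ i * x $ j)) else 0)"
    by (subst sum_upper_support[of A "\<lambda>i j. - 2 * (A $$ (i, j) * (x $ i * x $ j))"]) (auto simp: n)
  also have "\<dots> = - (\<Sum>i<n. \<Sum>j<n. if i < j then A $$ (i, j) * (x $ i * x $ j) + A $$ (j, i) * (x $ j * x $ i) else 0)"
    unfolding sum_negf[symmetric] using sdd_sym[OF A(2)] n by (intro sum.cong) auto
  finally show ?thesis
    unfolding quad_form_sum[OF A(1) x] sum_symmetric_split[of "\<lambda>i j. A $$ (i, j) * (x $ i * x $ j)"]
    by (simp add: power2_eq_square)
qed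

lemma energy_eq_mass: "energy w H y = mass w H (\<lambda>u. (y u)\<^sup>2) - 2 * (\<Sum>e\<in>H. w e * (y (fst e) * y (snd e)))"
  by (simp add: energy_def mass_def sum_distrib_left sum_subtractf[symmetric] power2_diff algebra_simps)

text \<open>Diagonal dominance enters here: it bounds the square terms of the energy by twice the
  diagonal part of the form. An error relative to the energy thereby becomes an error relative to
  the form.\<close>

lemma energy_cover_le:
  assumes A: "A \<in> carrier_mat n n" "sdd A" and x: "x \<in> carrier_vec n"
  shows "energy (weight A) (cover_edges A) (lift_vec x) \<le> 2 * quad_form A x"
proof -
  have n: "dim_row A = n" using A by auto
  have "mass (weight A) (cover_edges A) (\<lambda>u. (lift_vec x u)\<^sup>2)
      = (\<Sum>ij\<in>upper_support A. 2 * (\<bar>A $$ (fst ij, snd ij)\<bar> * ((x $ fst ij)\<^sup>2 + (x $ snd ij)\<^sup>2)))"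
    unfolding mass_def sum_cover_edges
    by (intro sum.cong) (auto simp: cover_edge_def weight_def entry_def lift_vec_def)
  also have "\<dots> = (\<Sum>i<n. \<Sum>j<n. if i < j then 2 * (\<bar>A $$ (i, j)\<bar> * ((x $ i)\<^sup>2 + (x $ j)\<^sup>2)) else 0)"
    by (subst sum_upper_support[of A "\<lambda>i j. 2 * (\<bar>A $$ (i, j)\<bar> * ((x $ i)\<^sup>2 + (x $ j)\<^sup>2))"]) (auto simp: n)
  also have "\<dots> = (\<Sum>i<n. \<Sum>j<n. if i < j then
      (if i = j then 0 else 2 * \<bar>A $$ (i, j)\<bar> * (x $ i)\<^sup>2) + (if j = i then 0 else 2 * \<bar>A $$ (j, i)\<bar> * (x $ j)\<^sup>2) else 0)"
    using sdd_sym[OF A(2)] n by (intro sum.cong) (auto simp: algebra_simps)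
  also have "\<dots> = (\<Sum>i<n. \<Sum>j<n. if i = j then 0 else 2 * \<bar>A $$ (i, j)\<bar> * (x $ i)\<^sup>2)"
    by (subst sum_symmetric_split[of "\<lambda>i j. if i = j then 0 else 2 * \<bar>A $$ (i, j)\<bar> * (x $ i)\<^sup>2"]) simp
  also have "\<dots> = (\<Sum>i<n. 2 * (\<Sum>j\<in>{..<n} - {i}. \<bar>A $$ (i, j)\<bar>) * (x $ i)\<^sup>2)"
    unfolding sum_distrib_left sum_distrib_right
    by (intro sum.cong refl sum.mono_neutral_cong_right) auto
  also have "\<dots> \<le> (\<Sum>i<n. 2 * A $$ (i, i) * (x $ i)\<^sup>2)"
    using A n by (intro sum_mono mult_right_mono) (auto simp: sdd_def)
  also have "\<dots> = 2 * (\<Sum>i<n. A $$ (i, i) * (x $ i)\<^sup>2)" by (simp add: sum_distrib_left mult.assoc)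
  finally show ?thesis unfolding quad_form_eq_cover[OF A x] energy_eq_mass by (simp add: algebra_simps)
qed

section \<open>The sketch\<close>

definition list_of :: "'a set \<Rightarrow> 'a list" where
  "list_of S = (SOME xs. distinct xs \<and> set xs = S)"

lemma list_of:
  assumes "finite S"
  shows "distinct (list_of S)" "set (list_of S) = S"
  using someI_ex[of "\<lambda>xs. distinct xs \<and> set xs = S"] finite_distinct_list[OF assms]
  unfolding list_of_def by blast+

lemma length_list_of: "finite S \<Longrightarrow> length (list_of S) = card S"
  using list_of[of S] distinct_card by metis

lemma sum_list_list_of: "finite S \<Longrightarrow> (\<Sum>x\<leftarrow>list_of S. f x) = (\<Sum>x\<in>S. f x)"
  using list_of[of S] by (metis sum.distinct_set_conv_list)

text \<open>Machine words admit sums of entries but not of absolute values, so a degree is kept as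
  two sums, one for each sign.\<close>

definition pos_sum :: "real mat \<Rightarrow> (vertex \<times> vertex) set \<Rightarrow> vertex \<Rightarrow> real" where
  "pos_sum A H u = (\<Sum>e\<in>{e \<in> H. (fst e = u \<or> snd e = u) \<and> 0 < entry A e}. entry A e)"

definition neg_sum :: "real mat \<Rightarrow> (vertex \<times> vertex) set \<Rightarrow> vertex \<Rightarrow> real" where
  "neg_sum A H u = (\<Sum>e\<in>{e \<in> H. (fst e = u \<or> snd e = u) \<and> entry A e < 0}. entry A e)"

text \<open>Heavy samples are dropped here, so the estimator need not test for them.\<close>

definition piece_data :: "real mat \<Rightarrow> nat \<Rightarrow> (vertex \<times> vertex) set \<Rightarrow>
    ((vertex \<times> vertex) set \<times> vertex \<times> vertex) list \<Rightarrow> piece" where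
  "piece_data A s H l =
    (map (\<lambda>u. (u, pos_sum A H u, neg_sum A H u)) (list_of (verts H)),
     map (\<lambda>e. (e, entry A e)) (list_of {e \<in> H. \<not> light s (weight A) H e}),
     map snd (filter (\<lambda>x. fst x = H \<and> light s (weight A) H (snd x)) l))"

definition sketch_of :: "real mat \<Rightarrow> nat \<Rightarrow> (vertex \<times> vertex) set set \<Rightarrow>
    ((vertex \<times> vertex) set \<times> vertex \<times> vertex) list \<Rightarrow> sketch_data" where
  "sketch_of A s P l =
    (map (\<lambda>i. A $$ (i, i)) [0..<dim_row A], replicate s (), map (\<lambda>H. piece_data A s H l) (list_of P))"

lemma cover_edges_cases:
  assumes "e \<in> cover_edges A"
  obtains i j b where "i < j" "j < dim_row A" "A $$ (i, j) \<noteq> 0" "e = ((i, b), (j, b \<noteq> (0 < A $$ (i, j))))"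
  using assms by (auto simp: cover_edges_def cover_edge_def upper_support_def)

lemma weight_pos: "e \<in> cover_edges A \<Longrightarrow> 0 < weight A e"
  by (auto simp: weight_def entry_def elim: cover_edges_cases)

lemma wdeg_eq_pos_neg:
  assumes "H \<subseteq> cover_edges A"
  shows "wdeg (weight A) H u = pos_sum A H u - neg_sum A H u"
proof -
  have fin: "finite H" using assms finite_cover_edges by (rule finite_subset)
  have "pos_sum A H u - neg_sum A H u
      = (\<Sum>e\<in>H. (if (fst e = u \<or> snd e = u) \<and> 0 < entry A e then entry A e else 0)
          - (if (fst e = u \<or> snd e = u) \<and> entry A e < 0 then entry A e else 0))"
    unfolding pos_sum_def neg_sum_def sum_subtractf using fin by (simp add: sum.inter_filter)
  also have "\<dots> = wdeg (weight A) H u"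
    unfolding wdeg_def vol_def mass_def
  proof (rule sum.cong)
    fix e assume "e \<in> H"
    \<comment> \<open>Cover edges are not loops, so an incident edge counts exactly once in the
      degree.\<close>
    then have "fst e \<noteq> snd e" using assms by (auto elim!: cover_edges_cases dest!: subsetD)
    then show "(if (fst e = u \<or> snd e = u) \<and> 0 < entry A e then entry A e else 0)
          - (if (fst e = u \<or> snd e = u) \<and> entry A e < 0 then entry A e else 0)
        = weight A e * (indicator {u} (fst e) + indicator {u} (snd e))"
      by (auto simp: weight_def indicator_def abs_real_def)
  qed simp
  finally show ?thesis ..
qed

lemma degree_of_piece:
  assumes "H \<subseteq> cover_edges A" "u \<in> verts H"
  shows "degree_of (map (\<lambda>u. (u, pos_sum A H u, neg_sum A H u)) (list_of (verts H))) u
    = wdeg (weight A) H u"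
proof -
  have fin: "finite H" using assms finite_cover_edges by (blast intro: finite_subset)
  show ?thesis
    using assms(2) list_of(2)[of "verts H"] fin
    by (simp add: degree_of_def map_of_map_restrict restrict_map_def wdeg_eq_pos_neg[OF assms(1)])
qed

lemma estimate_piece_data:
  fixes y :: "vertex \<Rightarrow> real"
  assumes H: "H \<subseteq> cover_edges A" and l: "\<And>e. (H, e) \<in> set l \<Longrightarrow> e \<in> H"
  defines "w \<equiv> weight A" and "z \<equiv> \<lambda>u. y u - wmean (weight A) H y"
  shows "estimate_piece s y (piece_data A s H l) = mass w H (\<lambda>u. (z u)\<^sup>2) - mass w H (\<lambda>u. (y u)\<^sup>2)
    - 2 * (\<Sum>e\<in>{e \<in> H. \<not> light s w H e}. w e * (z (fst e) * z (snd e)))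
    - 2 * ((\<Sum>x\<leftarrow>filter (\<lambda>x. fst x = H \<and> light s w H (snd x)) l. sample_term (wdeg w H) z (snd x)) / s)"
proof -
  have fin: "finite H" using H finite_cover_edges by (rule finite_subset)
  define rs where "rs = map (\<lambda>u. (u, pos_sum A H u, neg_sum A H u)) (list_of (verts H))"
  have us: "map fst rs = list_of (verts H)" by (simp add: rs_def o_def)
  have D: "degree_of rs u = wdeg w H u" if "u \<in> verts H" for u
    using degree_of_piece[OF H that] by (simp add: rs_def w_def)
  have sum_D: "(\<Sum>u\<leftarrow>map fst rs. degree_of rs u * f u) = mass w H f" for f
    unfolding us using fin D by (simp add: sum_list_list_of mass_eq_sum_wdeg)
  have "(\<Sum>u\<leftarrow>map fst rs. degree_of rs u) = vol w H UNIV"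
    using sum_D[of "indicator UNIV"] by (simp add: vol_def)
  then have m: "(\<Sum>u\<leftarrow>map fst rs. degree_of rs u * y u) / (\<Sum>u\<leftarrow>map fst rs. degree_of rs u) = wmean w H y"
    by (simp only: sum_D wmean_def)

  have "sample_term (degree_of rs) z e = sample_term (wdeg w H) z e" if "e \<in> H" for e
    using D that by (auto simp: sample_term_def verts_def)
  then have smp: "(\<Sum>e\<leftarrow>map snd (filter (\<lambda>x. fst x = H \<and> light s w H (snd x)) l). sample_term (degree_of rs) z e)
      = (\<Sum>x\<leftarrow>filter (\<lambda>x. fst x = H \<and> light s w H (snd x)) l. sample_term (wdeg w H) z (snd x))"
    using l by (auto simp: o_def intro!: arg_cong[of _ _ sum_list] map_cong)
  show ?thesis
    unfolding piece_data_def estimate_piece_def rs_def[symmetric] w_def[symmetric] prod.case Let_def m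
    unfolding sum_D using fin smp by (simp add: z_def w_def o_def sum_list_list_of weight_def)
qed

lemma sum_filter_eq_sample_sum:
  assumes "finite P" "\<And>x. x \<in> set l \<Longrightarrow> fst x \<in> P"
  shows "(\<Sum>H\<in>P. \<Sum>x\<leftarrow>filter (\<lambda>x. fst x = H \<and> light s w H (snd x)) l. sample_term (wdeg w H) (z H) (snd x))
    = sample_sum s w z l"
  using assms(2)
proof (induction l)
  case (Cons x l)
  have "(\<Sum>H\<in>P. \<Sum>x\<leftarrow>filter (\<lambda>x. fst x = H \<and> light s w H (snd x)) (x # l). sample_term (wdeg w H) (z H) (snd x))
      = (\<Sum>H\<in>P. (if H = fst x then if light s w H (snd x) then sample_term (wdeg w H) (z H) (snd x) else 0 else 0)
          + (\<Sum>x\<leftarrow>filter (\<lambda>x. fst x = H \<and> light s w H (snd x)) l. sample_term (wdeg w H) (z H) (snd x)))"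
    by (intro sum.cong) auto
  then show ?case
    using Cons assms(1) by (simp add: sum.distrib sample_sum_def case_prod_unfold sum.delta)
qed (simp add: sample_sum_def)

text \<open>Shift invariance of the energy, solved for the cross terms.\<close>

lemma mass_diff_eq:
  "(mass w H (\<lambda>u. (y u - c)\<^sup>2) - mass w H (\<lambda>u. (y u)\<^sup>2)) / 2
    = (\<Sum>e\<in>H. w e * ((y (fst e) - c) * (y (snd e) - c))) - (\<Sum>e\<in>H. w e * (y (fst e) * y (snd e)))"
  using energy_shift[of w H y c] unfolding energy_eq_mass by simp

text \<open>Diagonal, degrees and heavy edges are reproduced exactly, so the whole error is the
  sampling error on the light cross terms.\<close>

lemma estimate_error:
  assumes A: "A \<in> carrier_mat n n" "sdd A" and x: "x \<in> carrier_vec n"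
    and P: "finite P" "\<Union>P = cover_edges A" "disjoint P" and l: "set l \<subseteq> (SIGMA H:P. H)"
  defines "w \<equiv> weight A" and "y \<equiv> lift_vec x"
  shows "quad_form A x - estimate_data (sketch_of A s P l) x
    = sample_sum s w (\<lambda>H u. y u - wmean w H y) l / s
      - (\<Sum>H\<in>P. \<Sum>e\<in>{e \<in> H. light s w H e}.
          w e * ((y (fst e) - wmean w H y) * (y (snd e) - wmean w H y)))"
proof -
  define z where "z H u = y u - wmean w H y" for H u
  define zz where "zz H e = w e * (z H (fst e) * z H (snd e))" for H e
  define smp where "smp H = (\<Sum>x\<leftarrow>filter (\<lambda>x. fst x = H \<and> light s w H (snd x)) l. sample_term (wdeg w H) (z H) (snd x))" for H
  have sub: "H \<subseteq> cover_edges A" if "H \<in> P" for H using that P(2) by auto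
  have fin: "finite H" if "H \<in> P" for H
    using sub[OF that] finite_cover_edges by (rule finite_subset)
  have n: "dim_row A = n" using A by auto
  have "estimate_piece s y (piece_data A s H l) / 2
      = (\<Sum>e\<in>{e \<in> H. light s w H e}. zz H e) - (\<Sum>e\<in>H. w e * (y (fst e) * y (snd e))) - smp H / s"
    if H: "H \<in> P" for H
  proof -
    have "e \<in> H" if "(H, e) \<in> set l" for e using that l by auto
    then have ep: "estimate_piece s y (piece_data A s H l) = mass w H (\<lambda>u. (z H u)\<^sup>2) - mass w H (\<lambda>u. (y u)\<^sup>2)
        - 2 * (\<Sum>e\<in>{e \<in> H. \<not> light s w H e}. zz H e) - 2 * (smp H / s)"
      unfolding zz_def smp_def z_def[abs_def] w_def by (rule estimate_piece_data[OF sub[OF H]])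
    have "(mass w H (\<lambda>u. (z H u)\<^sup>2) - mass w H (\<lambda>u. (y u)\<^sup>2)) / 2
        = (\<Sum>e\<in>H. zz H e) - (\<Sum>e\<in>H. w e * (y (fst e) * y (snd e)))"
      unfolding zz_def z_def by (rule mass_diff_eq)
    moreover have "(\<Sum>e\<in>H. zz H e) = (\<Sum>e\<in>{e \<in> H. light s w H e}. zz H e) + (\<Sum>e\<in>{e \<in> H. \<not> light s w H e}. zz H e)"
      using fin[OF H] by (subst sum.union_disjoint[symmetric]) (auto intro!: sum.cong)
    ultimately show ?thesis unfolding ep by (simp add: diff_divide_distrib)
  qed
  then have "(\<Sum>H\<in>P. estimate_piece s y (piece_data A s H l) / 2)
      = (\<Sum>H\<in>P. (\<Sum>e\<in>{e \<in> H. light s w H e}. zz H e) - (\<Sum>e\<in>H. w e * (y (fst e) * y (snd e))) - smp H / s)"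
    by (rule sum.cong[OF refl])
  also have "\<dots> = (\<Sum>H\<in>P. \<Sum>e\<in>{e \<in> H. light s w H e}. zz H e)
      - (\<Sum>H\<in>P. \<Sum>e\<in>H. w e * (y (fst e) * y (snd e))) - (\<Sum>H\<in>P. smp H) / s"
    by (simp add: sum_subtractf sum_divide_distrib)
  also have "(\<Sum>H\<in>P. smp H) = sample_sum s w z l"
    unfolding smp_def using l by (intro sum_filter_eq_sample_sum P(1)) auto
  also have "(\<Sum>H\<in>P. \<Sum>e\<in>H. w e * (y (fst e) * y (snd e)))
      = (\<Sum>e\<in>cover_edges A. w e * (y (fst e) * y (snd e)))"
    unfolding P(2)[symmetric] using fin P(3)
    by (subst sum.Union_disjoint) (auto simp: pairwise_def disjnt_def)
  finally have "(\<Sum>H\<in>P. estimate_piece s y (piece_data A s H l)) / 2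
      = (\<Sum>H\<in>P. \<Sum>e\<in>{e \<in> H. light s w H e}. zz H e)
        - (\<Sum>e\<in>cover_edges A. w e * (y (fst e) * y (snd e))) - sample_sum s w z l / s"
    by (simp add: sum_divide_distrib)
  moreover have "estimate_data (sketch_of A s P l) x
      = (\<Sum>i<n. A $$ (i, i) * (x $ i)\<^sup>2) + (\<Sum>H\<in>P. estimate_piece s y (piece_data A s H l)) / 2"
    using P(1) by (simp add: estimate_data_def sketch_of_def n o_def sum_list_list_of y_def)
  moreover have "quad_form A x = (\<Sum>i<n. A $$ (i, i) * (x $ i)\<^sup>2)
      - (\<Sum>e\<in>cover_edges A. w e * (y (fst e) * y (snd e)))"
    unfolding w_def y_def by (rule quad_form_eq_cover[OF A x])
  ultimately have "quad_form A x - estimate_data (sketch_of A s P l) x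
      = sample_sum s w z l / s - (\<Sum>H\<in>P. \<Sum>e\<in>{e \<in> H. light s w H e}. zz H e)"
    by linarith
  then show ?thesis unfolding zz_def z_def[abs_def] .
qed

section \<open>Machine words and size of the sketch\<close>

lemma Value_in_machine_words:
  assumes "S \<subseteq> {..<dim_row A} \<times> {..<dim_col A}"
  shows "Value (\<Sum>p\<in>S. A $$ p) \<in> machine_words A"
  using assms unfolding machine_words_def by blast

lemma entry_in_machine_words:
  assumes "i < dim_row A" "j < dim_col A"
  shows "Value (A $$ (i, j)) \<in> machine_words A"
  using Value_in_machine_words[of "{(i, j)}" A] assms by simp

text \<open>The two cover edges of one entry share no vertex. Edges at a common vertex thus belong
  to distinct index pairs, and their sum is a sum over a set of entries, without repetition.\<close>

lemma incident_sum_in_machine_words: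
  assumes "square_mat A" "T \<subseteq> {e \<in> cover_edges A. fst e = u \<or> snd e = u}"
  shows "Value (\<Sum>e\<in>T. entry A e) \<in> machine_words A"
proof -
  define ix where "ix e = (fst (fst e), fst (snd e))" for e :: "vertex \<times> vertex"
  have "inj_on ix T"
  proof (rule inj_onI)
    fix e f assume ef: "e \<in> T" "f \<in> T" "ix e = ix f"
    obtain i j b where e: "i < j" "e = ((i, b), (j, b \<noteq> (0 < A $$ (i, j))))"
      using ef(1) assms(2) by (auto elim!: cover_edges_cases)
    obtain i' j' b' where f: "i' < j'" "f = ((i', b'), (j', b' \<noteq> (0 < A $$ (i', j'))))"
      using ef(2) assms(2) by (auto elim!: cover_edges_cases)
    have "i' = i" "j' = j" using ef(3) e(2) f(2) by (auto simp: ix_def)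
    moreover have "fst e = u \<or> snd e = u" "fst f = u \<or> snd f = u" using ef(1,2) assms(2) by auto
    ultimately show "e = f" using e f by auto
  qed
  then have "(\<Sum>p\<in>ix ` T. A $$ p) = (\<Sum>e\<in>T. A $$ ix e)" by (simp add: sum.reindex)
  then have "(\<Sum>e\<in>T. entry A e) = (\<Sum>p\<in>ix ` T. A $$ p)" by (simp add: entry_def ix_def)
  moreover have "ix ` T \<subseteq> {..<dim_row A} \<times> {..<dim_col A}"
    using assms by (auto simp: ix_def elim!: cover_edges_cases)
  ultimately show ?thesis by (simp add: Value_in_machine_words)
qed

lemma set_enc_prod: "set (enc_prod c d x) = set (c (fst x)) \<union> set (d (snd x))"
  by (simp add: enc_prod_def)

lemma set_sketch_subset:
  assumes A: "square_mat A" "2 \<le> dim_row A" and P: "finite P" "\<Union>P \<subseteq> cover_edges A"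
    and l: "set l \<subseteq> (SIGMA H:P. H)"
  shows "set (enc_sketch (sketch_of A s P l)) \<subseteq> machine_words A"
proof -
  let ?W = "machine_words A"
  have ix: "Index i \<in> ?W" if "i < dim_row A" for i
    using that by (auto simp: machine_words_def)
  \<comment> \<open>Both marker words are admissible indices because the dimension is at least
    2.\<close>
  have bits: "Index 0 \<in> ?W" "Index 1 \<in> ?W" using A(2) by (auto intro!: ix)
  have vertex: "set (enc_vertex u) \<subseteq> ?W" if "fst u < dim_row A" for u
    using that ix bits by (simp add: enc_vertex_def set_enc_prod enc_bool_def of_bool_def)
  have ends: "fst (fst e) < dim_row A" "fst (snd e) < dim_row A" "Value (entry A e) \<in> ?W"
    if "e \<in> cover_edges A" for e
    using that A(1) entry_in_machine_words[of "fst (fst e)" A "fst (snd e)"]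
    by (auto elim!: cover_edges_cases simp: entry_def)
  have list: "set (enc_list c xs) \<subseteq> ?W" if "\<And>x. x \<in> set xs \<Longrightarrow> set (c x) \<subseteq> ?W"
    for c :: "'x \<Rightarrow> mword list" and xs
    using set_enc_list[of c xs] bits that by blast
  have piece: "set (enc_piece (piece_data A s H l)) \<subseteq> ?W" if H: "H \<in> P" for H
  proof -
    have sub: "H \<subseteq> cover_edges A" using H P(2) by auto
    then have fin: "finite H" using finite_cover_edges by (rule finite_subset)
    have edge: "set (enc_vertex (fst e)) \<subseteq> ?W \<and> set (enc_vertex (snd e)) \<subseteq> ?W \<and> Value (entry A e) \<in> ?W"
      if "e \<in> H" for e
      using that sub ends[of e] vertex by blast
    then have vertex': "set (enc_vertex u) \<subseteq> ?W" if "u \<in> verts H" for u using that unfolding verts_def by blast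
    have sums: "Value (pos_sum A H u) \<in> ?W" "Value (neg_sum A H u) \<in> ?W" for u
      unfolding pos_sum_def neg_sum_def using sub
      by (auto intro!: incident_sum_in_machine_words[OF A(1), of _ u])
    have "set (enc_list (enc_prod enc_vertex (enc_prod (\<lambda>v. [Value v]) (\<lambda>v. [Value v])))
        (map (\<lambda>u. (u, pos_sum A H u, neg_sum A H u)) (list_of (verts H)))) \<subseteq> ?W"
    proof (rule list)
      fix x assume "x \<in> set (map (\<lambda>u. (u, pos_sum A H u, neg_sum A H u)) (list_of (verts H)))"
      then obtain u where "u \<in> verts H" "x = (u, pos_sum A H u, neg_sum A H u)"
        using fin by (auto simp: list_of)
      then show "set (enc_prod enc_vertex (enc_prod (\<lambda>v. [Value v]) (\<lambda>v. [Value v])) x) \<subseteq> ?W"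
        using vertex'[of u] sums[of u] by (simp add: set_enc_prod)
    qed
    moreover have "set (enc_list (enc_prod (enc_prod enc_vertex enc_vertex) (\<lambda>v. [Value v]))
        (map (\<lambda>e. (e, entry A e)) (list_of {e \<in> H. \<not> light s (weight A) H e}))) \<subseteq> ?W"
    proof (rule list)
      fix x assume "x \<in> set (map (\<lambda>e. (e, entry A e)) (list_of {e \<in> H. \<not> light s (weight A) H e}))"
      then obtain e where "e \<in> H" "x = (e, entry A e)" using fin by (auto simp: list_of)
      then show "set (enc_prod (enc_prod enc_vertex enc_vertex) (\<lambda>v. [Value v]) x) \<subseteq> ?W"
        using edge[of e] by (simp add: set_enc_prod)
    qed
    moreover have "set (enc_list (enc_prod enc_vertex enc_vertex)
        (map snd (filter (\<lambda>x. fst x = H \<and> light s (weight A) H (snd x)) l))) \<subseteq> ?W"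
    proof (rule list)
      fix e assume "e \<in> set (map snd (filter (\<lambda>x. fst x = H \<and> light s (weight A) H (snd x)) l))"
      then have "e \<in> H" using l by auto
      then show "set (enc_prod enc_vertex enc_vertex e) \<subseteq> ?W"
        using edge[of e] by (simp add: set_enc_prod)
    qed
    ultimately show ?thesis by (simp add: enc_piece_def piece_data_def set_enc_prod)
  qed
  have "set (enc_list enc_piece (map (\<lambda>H. piece_data A s H l) (list_of P))) \<subseteq> ?W"
  proof (rule list)
    fix pc assume "pc \<in> set (map (\<lambda>H. piece_data A s H l) (list_of P))"
    then obtain H where "H \<in> P" "pc = piece_data A s H l" using P(1) by (auto simp: list_of)
    then show "set (enc_piece pc) \<subseteq> ?W" using piece by simp
  qed
  moreover have "set (enc_list (\<lambda>v. [Value v]) (map (\<lambda>i. A $$ (i, i)) [0..<dim_row A])) \<subseteq> ?W"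
    using A(1) entry_in_machine_words[of _ A] by (intro list) auto
  moreover have "set (enc_list (\<lambda>_. []) (replicate s ())) \<subseteq> ?W" by (intro list) simp
  ultimately show ?thesis by (simp add: enc_sketch_def sketch_of_def set_enc_prod)
qed

lemma sum_list_length_filter_fst:
  assumes "finite P"
  shows "(\<Sum>H\<in>P. length (filter (\<lambda>x. fst x = H \<and> Q H x) l)) \<le> length l"
proof (induction l)
  case (Cons x l)
  have "(\<Sum>H\<in>P. length (filter (\<lambda>x. fst x = H \<and> Q H x) (x # l)))
      \<le> (\<Sum>H\<in>P. (if H = fst x then 1 else 0) + length (filter (\<lambda>x. fst x = H \<and> Q H x) l))"
    by (intro sum_mono) auto
  also have "\<dots> \<le> length (x # l)"
    using Cons assms by (simp add: sum.distrib sum.delta)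
  finally show ?case .
qed simp

lemma length_sketch_le:
  assumes P: "finite P" "\<Union>P \<subseteq> cover_edges A" "\<And>H. H \<in> P \<Longrightarrow> H \<noteq> {}"
    and l: "length l = (\<Sum>H\<in>P. card (verts H)) * s"
  shows "length (enc_sketch (sketch_of A s P l))
    \<le> 3 + 2 * dim_row A + s + (\<Sum>H\<in>P. card (verts H)) * (9 + 11 * s)"
proof -
  define M where "M = (\<Sum>H\<in>P. card (verts H))"
  have "length (enc_piece (piece_data A s H l)) + 1
      \<le> card (verts H) * (9 + 6 * s) + 5 * length (filter (\<lambda>x. fst x = H \<and> light s (weight A) H (snd x)) l)"
    if H: "H \<in> P" for H
  proof -
    have sub: "H \<subseteq> cover_edges A" using H P(2) by auto
    then have fin: "finite H" using finite_cover_edges by (rule finite_subset)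
    \<comment> \<open>Three end marks and the mark of the piece in the outer list are charged to its
      vertices, of which there is at least one; with 5 words per vertex record this gives 9.\<close>
    have "0 < card (verts H)" using fin P(3)[OF H] by (auto simp: card_gt_0_iff verts_def)
    moreover have "card {e \<in> H. \<not> light s (weight A) H e} \<le> s * card (verts H)"
      using sub weight_pos by (intro card_heavy_le fin) auto
    ultimately show ?thesis
      using fin by (simp add: piece_data_def length_enc_piece length_list_of algebra_simps)
  qed
  then have "(\<Sum>H\<in>P. length (enc_piece (piece_data A s H l)) + 1)
      \<le> (\<Sum>H\<in>P. card (verts H) * (9 + 6 * s) + 5 * length (filter (\<lambda>x. fst x = H \<and> light s (weight A) H (snd x)) l))"
    by (rule sum_mono)
  also have "\<dots> = M * (9 + 6 * s) + 5 * (\<Sum>H\<in>P. length (filter (\<lambda>x. fst x = H \<and> light s (weight A) H (snd x)) l))"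
    by (simp add: M_def sum.distrib sum_distrib_left sum_distrib_right)
  also have "\<dots> \<le> M * (9 + 6 * s) + 5 * (M * s)"
    using sum_list_length_filter_fst[OF P(1), of "\<lambda>H x. light s (weight A) H (snd x)" l] l
    by (simp add: M_def)
  finally have "(\<Sum>H\<in>P. 1 + length (enc_piece (piece_data A s H l))) \<le> M * (9 + 11 * s)"
    by (simp add: algebra_simps)
  then show ?thesis
    using P(1)
    by (simp add: enc_sketch_def sketch_of_def enc_prod_def length_enc_list o_def sum_list_triv
        sum_list_replicate sum_list_list_of M_def[symmetric])
qed

section \<open>The range of the weights and the volume of the cover\<close>

lemma w_max_ge:
  assumes "i < dim_row A" "j < dim_col A"
  shows "\<bar>A $$ (i, j)\<bar> \<le> w_max A"
  unfolding w_max_def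
proof (rule Max_ge)
  have "{\<bar>A $$ (i, j)\<bar> | i j. i < dim_row A \<and> j < dim_col A}
      = (\<lambda>(i, j). \<bar>A $$ (i, j)\<bar>) ` ({..<dim_row A} \<times> {..<dim_col A})" by auto
  then show "finite {\<bar>A $$ (i, j)\<bar> | i j. i < dim_row A \<and> j < dim_col A}" by simp
qed (use assms in blast)

lemma
  assumes "i < dim_row A" "j < dim_col A" "A $$ (i, j) \<noteq> 0"
  shows w_min_le: "w_min A \<le> \<bar>A $$ (i, j)\<bar>" and w_min_pos: "0 < w_min A"
proof -
  define S where "S = {\<bar>A $$ (i, j)\<bar> | i j. i < dim_row A \<and> j < dim_col A \<and> A $$ (i, j) \<noteq> 0}"
  have "S \<subseteq> (\<lambda>(i, j). \<bar>A $$ (i, j)\<bar>) ` ({..<dim_row A} \<times> {..<dim_col A})" by (auto simp: S_def)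
  then have fin: "finite S" by (rule finite_subset) simp
  have mem: "\<bar>A $$ (i, j)\<bar> \<in> S" using assms by (auto simp: S_def)
  show "w_min A \<le> \<bar>A $$ (i, j)\<bar>" unfolding w_min_def S_def[symmetric] using fin mem by (rule Min_le)
  have "Min S \<in> S" using fin mem by (intro Min_in) auto
  then show "0 < w_min A" unfolding w_min_def S_def[symmetric] by (auto simp: S_def)
qed

lemma cover_edges_subset: "cover_edges A \<subseteq> ({..<dim_row A} \<times> UNIV) \<times> ({..<dim_row A} \<times> UNIV)"
  by (auto elim!: cover_edges_cases)

text \<open>There are at most \<open>4 * n\<^sup>2\<close> edges, as pairs of the
  \<open>2 * n\<close> vertices, and each adds at most \<open>2 * w_max A\<close> to the volume. The
  lower bound on \<open>L\<close> is the binary logarithm of the resulting factor; its summand 3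
  comes from 8.\<close>

lemma vol_cover_edges_le:
  assumes A: "A \<in> carrier_mat n n" and e: "cover_edges A \<noteq> {}"
    and ratio: "w_max A / w_min A \<le> n powr C" and n: "2 \<le> n"
    and L: "3 + (2 + \<bar>C\<bar>) * log 2 n \<le> real L"
  shows "vol (weight A) (cover_edges A) UNIV \<le> w_min A * 2 ^ L" "0 < w_min A"
    "\<forall>e\<in>cover_edges A. w_min A \<le> weight A e"
proof -
  have dims: "dim_row A = n" "dim_col A = n" using A by auto
  have bounds: "w_min A \<le> weight A e \<and> weight A e \<le> w_max A \<and> 0 < w_min A" if "e \<in> cover_edges A" for e
    using that
  proof (cases rule: cover_edges_cases)
    case (1 i j b)
    then show ?thesis
      using w_min_le[of i A j] w_min_pos[of i A j] w_max_ge[of i A j] dims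
      by (simp add: weight_def entry_def)
  qed
  then show pos: "0 < w_min A" and "\<forall>e\<in>cover_edges A. w_min A \<le> weight A e" using e by auto
  have max0: "0 \<le> w_max A" using bounds e by (metis all_not_in_conv less_le_trans less_imp_le)
  have "card (cover_edges A) \<le> card (({..<dim_row A} \<times> (UNIV :: bool set)) \<times> ({..<dim_row A} \<times> (UNIV :: bool set)))"
    by (intro card_mono cover_edges_subset) simp
  then have card: "card (cover_edges A) \<le> 4 * n\<^sup>2"
    by (simp add: card_cartesian_product dims power2_eq_square UNIV_bool algebra_simps)
  have "vol (weight A) (cover_edges A) UNIV \<le> 2 * (card (cover_edges A) * w_max A)"
    unfolding vol_UNIV using sum_bounded_above[of "cover_edges A" "weight A" "w_max A"] bounds by simp
  also have "\<dots> \<le> 2 * (real (4 * n\<^sup>2) * w_max A)"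
    using card max0 by (intro mult_left_mono mult_right_mono) (auto simp del: of_nat_mult of_nat_power)
  also have "\<dots> = 8 * n\<^sup>2 * w_max A" by simp
  also have "\<dots> \<le> 8 * n\<^sup>2 * (n powr C * w_min A)"
    using ratio pos by (intro mult_left_mono) (simp_all add: field_simps)
  also have "\<dots> \<le> 8 * n\<^sup>2 * (n powr \<bar>C\<bar> * w_min A)"
    using pos n by (intro mult_left_mono mult_right_mono powr_mono) auto
  also have "\<dots> = w_min A * 2 powr (3 + (2 + \<bar>C\<bar>) * log 2 n)"
  proof -
    have "2 powr ((2 + \<bar>C\<bar>) * log 2 n) = (2 powr log 2 n) powr (2 + \<bar>C\<bar>)"
      by (simp add: powr_powr mult.commute)
    also have "2 powr log 2 n = n" using n by simp
    also have "n powr (2 + \<bar>C\<bar>) = n\<^sup>2 * n powr \<bar>C\<bar>" using n by (simp add: powr_add powr_numeral)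
    finally show ?thesis by (simp add: powr_add powr_numeral)
  qed
  also have "\<dots> \<le> w_min A * 2 powr L"
    using L pos by (intro mult_left_mono powr_mono) auto
  finally show "vol (weight A) (cover_edges A) UNIV \<le> w_min A * 2 ^ L" by (simp add: powr_realpow)
qed

lemma energy_Union_disjoint:
  assumes "\<And>H. H \<in> P \<Longrightarrow> finite H" "disjoint P"
  shows "energy w (\<Union>P) y = (\<Sum>H\<in>P. energy w H y)"
  unfolding energy_def using assms
  by (subst sum.Union_disjoint) (auto simp: pairwise_def disjnt_def)

section \<open>Assembly of the sketch and its size\<close>

lemma sdd_sketch_exists:
  assumes A: "A \<in> carrier_mat n n" "sdd A" and n: "2 \<le> n"
    and ratio: "w_max A / w_min A \<le> n powr C" and \<epsilon>: "0 < \<epsilon>"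
    and L: "3 + (2 + \<bar>C\<bar>) * log 2 n \<le> real L" and s: "640 * (real L)\<^sup>2 / \<epsilon> \<le> s"
  shows "\<exists>p. (\<forall>x\<in>carrier_vec n. approximates p (\<lambda>t. estimate_words t x) \<epsilon> (1 / 100) (quad_form A x)) \<and>
    (\<forall>t\<in>set_pmf p. set t \<subseteq> machine_words A \<and>
      length t \<le> 3 + 2 * n + s + L * (2 * n) * (9 + 11 * s))"
proof -
  let ?w = "weight A"
  have dims: "dim_row A = n" "square_mat A" using A by (auto simp: square_mat.simps)
  have "0 \<le> log 2 n" using n by simp
  then have "0 < real L" using L by (smt (verit) mult_nonneg_nonneg)
  then have L0: "0 < 1 / (4 * real L)" by simp
  \<comment> \<open>Without off-diagonal entries there are no edges to bound, and
    \<open>w_min A\<close> may be unspecified; any positive number then serves.\<close>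
  define w0 where "w0 = (if cover_edges A = {} then 1 else w_min A)"
  have w0: "0 < w0" "\<forall>e\<in>cover_edges A. w0 \<le> ?w e" "vol ?w (cover_edges A) UNIV \<le> w0 * 2 ^ L"
    using vol_cover_edges_le[OF A(1) _ ratio n L] by (auto simp: w0_def vol_UNIV)
  define V where "V = {..<n} \<times> (UNIV :: bool set)"
  have V: "finite V" "verts (cover_edges A) \<subseteq> V" "card V = 2 * n"
    using cover_edges_subset[of A] by (auto simp: V_def verts_def dims card_cartesian_product UNIV_bool)
  obtain P where P: "\<forall>H\<in>P. H \<noteq> {} \<and> expander (1 / (4 * real L)) ?w H" "\<Union>P = cover_edges A"
    "disjoint P" "(\<Sum>H\<in>P. card (verts H)) \<le> L * card V"
    using expander_decomposition[OF finite_cover_edges w0(2,1,3) order_refl V(1,2)] by (elim exE conjE) rule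
  have finP: "finite P" using P(2) finite_cover_edges[of A] by (metis finite_UnionD)
  have sub: "H \<subseteq> cover_edges A" if "H \<in> P" for H using that P(2) by blast
  have finH: "finite H" if "H \<in> P" for H using sub[OF that] finite_cover_edges by (rule finite_subset)
  \<comment> \<open>The constant 640 is 40 times 16, the 16 coming from the conductance
    \<open>1 / (4 * real L)\<close>.\<close>
  have rate: "40 / (\<epsilon> * (1 / (4 * real L))\<^sup>2) \<le> s"
    using s \<open>0 < real L\<close> \<epsilon> by (simp add: power_divide power_mult_distrib)
  have pieces: "\<forall>H\<in>P. finite H \<and> H \<noteq> {} \<and> expander (1 / (4 * real L)) ?w H \<and> (\<forall>e\<in>H. 0 < ?w e)"
    using finH P(1) sub weight_pos by blast
  obtain p where
    p: "\<forall>l\<in>set_pmf p. set l \<subseteq> (SIGMA H:P. H) \<and> length l = (\<Sum>H\<in>P. card (verts H)) * s"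
    "\<forall>y. 1 - 1 / 100 \<le> measure_pmf.prob p {l. \<bar>sample_sum s ?w (\<lambda>H u. y u - wmean ?w H y) l / s
        - (\<Sum>H\<in>P. \<Sum>e\<in>{e \<in> H. light s ?w H e}.
            ?w e * ((y (fst e) - wmean ?w H y) * (y (snd e) - wmean ?w H y)))\<bar>
      \<le> \<epsilon> / 2 * (\<Sum>H\<in>P. energy ?w H y)}"
    using expander_edge_sampling[OF finP pieces rate L0 \<epsilon>] by (elim exE conjE) rule
  define enc where "enc l = enc_sketch (sketch_of A s P l)" for l
  show ?thesis
  proof (intro exI[of _ "map_pmf enc p"] conjI ballI)
    fix x :: "real vec" assume x: "x \<in> carrier_vec n"
    define Q where "Q = quad_form A x"
    define y where "y = lift_vec x"
    have "(\<Sum>H\<in>P. energy ?w H y) \<le> 2 * Q"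
      using energy_cover_le[OF A x] energy_Union_disjoint[OF finH P(3), of ?w y] P(2)
      by (simp add: Q_def y_def)
    then have Q: "\<epsilon> / 2 * (\<Sum>H\<in>P. energy ?w H y) \<le> \<epsilon> * Q" using \<epsilon> by simp
    let ?B = "{l. \<bar>sample_sum s ?w (\<lambda>H u. y u - wmean ?w H y) l / s
        - (\<Sum>H\<in>P. \<Sum>e\<in>{e \<in> H. light s ?w H e}.
            ?w e * ((y (fst e) - wmean ?w H y) * (y (snd e) - wmean ?w H y)))\<bar>
      \<le> \<epsilon> / 2 * (\<Sum>H\<in>P. energy ?w H y)}"
    let ?G = "{l. (1 - \<epsilon>) * Q \<le> estimate_words (enc l) x \<and> estimate_words (enc l) x \<le> (1 + \<epsilon>) * Q}"
    \<comment> \<open>The error formula holds only for lists of samples from the pieces, hence the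
      restriction to the support.\<close>
    have "?B \<inter> set_pmf p \<subseteq> ?G"
    proof
      fix l assume l: "l \<in> ?B \<inter> set_pmf p"
      have "estimate_words (enc l) x = estimate_data (sketch_of A s P l) x"
        by (simp add: estimate_words_def enc_def inv_into_f_f[OF inj_enc_sketch])
      moreover have "\<bar>Q - estimate_data (sketch_of A s P l) x\<bar> \<le> \<epsilon> * Q"
        using l Q estimate_error[OF A x finP P(2,3), of l s] p(1)
        by (simp add: Q_def y_def)
      ultimately show "l \<in> ?G" by (auto simp: algebra_simps abs_le_iff)
    qed
    then have "measure_pmf.prob p (?B \<inter> set_pmf p) \<le> measure_pmf.prob p ?G"
      by (intro measure_pmf.finite_measure_mono) simp_all
    then have "measure_pmf.prob p ?B \<le> measure_pmf.prob p ?G" by (simp only: measure_Int_set_pmf)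
    with p(2)[rule_format, of y] show "approximates (map_pmf enc p) (\<lambda>t. estimate_words t x) \<epsilon> (1 / 100) (quad_form A x)"
      by (simp add: approximates_def measure_map_pmf vimage_def Q_def)
  next
    fix t assume "t \<in> set_pmf (map_pmf enc p)"
    then obtain l where l: "l \<in> set_pmf p" "t = enc_sketch (sketch_of A s P l)" by (auto simp: enc_def)
    show "set t \<subseteq> machine_words A"
      unfolding l(2) using dims n finP P(2) p(1) l(1) by (intro set_sketch_subset) auto
    have "length t \<le> 3 + 2 * n + s + (\<Sum>H\<in>P. card (verts H)) * (9 + 11 * s)"
      unfolding l(2) using length_sketch_le[of P A l s] dims finP P(1,2) p(1) l(1) by auto
    also have "\<dots> \<le> 3 + 2 * n + s + L * (2 * n) * (9 + 11 * s)"
      using P(4) V(3) by (intro add_left_mono mult_right_mono) auto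
    finally show "length t \<le> 3 + 2 * n + s + L * (2 * n) * (9 + 11 * s)" .
  qed
qed

text \<open>The size is of order \<open>n * L * s\<close>, with \<open>L\<close> of order
  \<open>ln n\<close> and \<open>s\<close> of order \<open>L\<^sup>2 / \<epsilon>\<close>. This
  gives \<open>n / \<epsilon>\<close> times a cubed logarithm, and replacing \<epsilon> by its
  smaller power with exponent 8 / 5 only enlarges the bound.\<close>

lemma sdd_sketch_soft_bound:
  fixes C :: real
  defines "B \<equiv> (6 + \<bar>C\<bar>) / ln 2"
  assumes A: "A \<in> carrier_mat n n" "sdd A" and ratio: "w_max A / w_min A \<le> n powr C"
    and \<epsilon>: "1 / n < \<epsilon>" "\<epsilon> < 1" and n: "1 \<le> n"
  shows "\<exists>p. (\<forall>x\<in>carrier_vec n. approximates p (\<lambda>t. estimate_words t x) \<epsilon> (1 / 100) (quad_form A x)) \<and>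
    (\<forall>t\<in>set_pmf p. set t \<subseteq> machine_words A \<and>
      length t \<le> soft_bound (29486 * B ^ 3) 3 (n / \<epsilon> powr (8 / 5)))"
proof -
  have \<epsilon>0: "0 < \<epsilon>" using \<epsilon>(1) by (meson divide_nonneg_nonneg le_less_trans of_nat_0_le_iff zero_le_one)
  \<comment> \<open>The interval between \<open>1 / n\<close> and 1 is empty for
    \<open>n = 1\<close>.\<close>
  have n2: "2 \<le> n" using \<epsilon> n by (cases "n = 1") auto
  define L where "L = nat \<lceil>3 + (2 + \<bar>C\<bar>) * log 2 n\<rceil>"
  define s where "s = nat \<lceil>640 * (real L)\<^sup>2 / \<epsilon>\<rceil>"
  have log1: "1 \<le> log 2 n" using n2 by simp
  have arg: "3 \<le> 3 + (2 + \<bar>C\<bar>) * log 2 n" using log1 by simp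
  have L: "3 + (2 + \<bar>C\<bar>) * log 2 n \<le> real L" unfolding L_def by linarith
  then have L1: "1 \<le> real L" using arg by linarith
  have "real L \<le> 4 + (2 + \<bar>C\<bar>) * log 2 n" using arg unfolding L_def by linarith
  also have "\<dots> \<le> (6 + \<bar>C\<bar>) * log 2 n" using log1 by (simp add: algebra_simps)
  also have "\<dots> = B * ln n" by (simp add: B_def log_def)
  finally have LB: "real L \<le> B * ln n" .
  have s: "640 * (real L)\<^sup>2 / \<epsilon> \<le> real s" unfolding s_def by linarith
  have L2: "1 \<le> (real L)\<^sup>2 / \<epsilon>"
    using \<epsilon> \<epsilon>0 one_le_power[OF L1, of 2] by (simp add: field_simps)
  have "real s \<le> 640 * (real L)\<^sup>2 / \<epsilon> + 1" using L2 unfolding s_def by linarith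
  \<comment> \<open>Rounding up costs at most 1, which is at most
    \<open>(real L)\<^sup>2 / \<epsilon>\<close>.\<close>
  then have sB: "real s \<le> 641 * ((real L)\<^sup>2 / \<epsilon>)" using L2 by simp
  have s1: "1 \<le> s" and L1': "1 \<le> L" using s L2 L1 by linarith+
  obtain p where p: "\<forall>x\<in>carrier_vec n. approximates p (\<lambda>t. estimate_words t x) \<epsilon> (1 / 100) (quad_form A x)"
    "\<forall>t\<in>set_pmf p. set t \<subseteq> machine_words A \<and> length t \<le> 3 + 2 * n + s + L * (2 * n) * (9 + 11 * s)"
    using sdd_sketch_exists[OF A n2 ratio \<epsilon>0 L s] by blast
  \<comment> \<open>The constant 46 is 6 for the terms \<open>3 + 2 * n + s\<close>, plus 18 and 22
    from the product. Multiplied by 641 it gives 29486.\<close>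
  have nat_bound: "3 + 2 * n + s + L * (2 * n) * (9 + 11 * s) \<le> 46 * (n * L * s)"
  proof -
    have "1 \<le> n * L * s" using n s1 L1' by (simp add: Suc_le_eq)
    moreover have "n \<le> n * L * s" "s \<le> n * L * s" "n * L \<le> n * L * s" using n s1 L1' by simp_all
    moreover have "L * (2 * n) * (9 + 11 * s) = 18 * (n * L) + 22 * (n * L * s)"
      by (simp add: algebra_simps)
    ultimately show ?thesis by linarith
  qed
  have "46 * real (n * L * s) \<le> soft_bound (29486 * B ^ 3) 3 (n / \<epsilon> powr (8 / 5))"
  proof -
    have lnn: "0 \<le> ln n" using n by simp
    have "46 * real (n * L * s) = 46 * (n * real L) * s" by simp
    also have "\<dots> \<le> 46 * (n * real L) * (641 * ((real L)\<^sup>2 / \<epsilon>))"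
      using sB by (intro mult_left_mono) auto
    also have "\<dots> = 29486 * (n / \<epsilon>) * real L ^ 3" by (simp add: power2_eq_square power3_eq_cube)
    also have "\<dots> \<le> 29486 * (n / \<epsilon>) * (B * ln n) ^ 3"
      using LB \<epsilon>0 by (intro mult_left_mono power_mono) auto
    also have "\<dots> = 29486 * B ^ 3 * (n / \<epsilon> * ln n ^ 3)" by (simp add: power_mult_distrib)
    also have "\<dots> \<le> 29486 * B ^ 3 * (n / \<epsilon> powr (8 / 5) * ln (n / \<epsilon> powr (8 / 5)) ^ 3)"
    proof (intro mult_left_mono mult_mono power_mono)
      have pw: "\<epsilon> powr (8 / 5) \<le> \<epsilon> powr 1" using \<epsilon>0 \<epsilon> by (intro powr_mono') auto
      then show "n / \<epsilon> \<le> n / \<epsilon> powr (8 / 5)" using \<epsilon>0 by (intro divide_left_mono) auto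
      have "\<epsilon> powr (8 / 5) \<le> 1" using pw \<epsilon> \<epsilon>0 by simp
      then have "real n \<le> n / \<epsilon> powr (8 / 5)" using \<epsilon>0 by (simp add: field_simps mult_left_le)
      then show "ln n \<le> ln (n / \<epsilon> powr (8 / 5))" using n by (intro ln_mono) auto
    qed (use \<epsilon>0 lnn in \<open>auto simp: B_def\<close>)
    finally show ?thesis by (simp add: soft_bound_def)
  qed
  moreover have "real (length t) \<le> 46 * real (n * L * s)" if "t \<in> set_pmf p" for t
  proof -
    have "length t \<le> 46 * (n * L * s)" using p(2) that nat_bound order_trans by blast
    then have "real (length t) \<le> real (46 * (n * L * s))" by (rule of_nat_mono)
    then show ?thesis by simp
  qed
  ultimately have "real (length t) \<le> soft_bound (29486 * B ^ 3) 3 (n / \<epsilon> powr (8 / 5))"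
    if "t \<in> set_pmf p" for t
    using that order_trans by blast
  then show ?thesis using p by (intro exI[of _ p]) simp
qed

theorem theoremB1:
  fixes C :: real
  shows "\<exists>(sketch :: real \<Rightarrow> real mat \<Rightarrow> mword list pmf)
           (estimate :: mword list \<Rightarrow> real vec \<Rightarrow> real) (K :: real) (c :: nat).
    \<forall>(n :: nat) (eps :: real) (A :: real mat).
      n \<ge> 1 \<and> A \<in> carrier_mat n n \<and> sdd A \<and> w_max A / w_min A \<le> real n powr C \<and>
      1 / real n < eps \<and> eps < 1 \<longrightarrow>
        (\<forall>x\<in>carrier_vec n.
           approximates (sketch eps A) (\<lambda>s. estimate s x) eps (1 / 100) (quad_form A x)) \<and>
        (\<forall>s\<in>set_pmf (sketch eps A).
           set s \<subseteq> machine_words A \<and>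
           real (length s) \<le> soft_bound K c (real n / eps powr (8 / 5)))"
proof -
  define K where "K = 29486 * ((6 + \<bar>C\<bar>) / ln 2) ^ 3"
  \<comment> \<open>The sketch must be a function of \<open>eps\<close> and \<open>A\<close> alone,
    with constants fixed before \<open>n\<close>. So \<open>n\<close> is read off as
    \<open>dim_row A\<close>, and a suitable distribution is chosen for each pair.\<close>
  define good where "good eps A p \<longleftrightarrow>
    (\<forall>x\<in>carrier_vec (dim_row A). approximates p (\<lambda>t. estimate_words t x) eps (1 / 100) (quad_form A x)) \<and>
    (\<forall>t\<in>set_pmf p. set t \<subseteq> machine_words A \<and>
      real (length t) \<le> soft_bound K 3 (real (dim_row A) / eps powr (8 / 5)))"
    for eps :: real and A :: "real mat" and p
  have "good eps A (SOME p. good eps A p)"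
    if "n \<ge> 1" "A \<in> carrier_mat n n" "sdd A" "w_max A / w_min A \<le> real n powr C"
      "1 / real n < eps" "eps < 1" for n eps A
    using sdd_sketch_soft_bound[OF that(2,3,4,5,6,1)] that(2)
    by (intro someI_ex[of "good eps A"]) (simp add: good_def K_def carrier_matD(1))
  note good = this
  show ?thesis
  proof (intro exI[of _ "\<lambda>eps A. SOME p. good eps A p"] exI[of _ estimate_words] exI[of _ K] exI[of _ 3]
        allI impI)
    fix n :: nat and eps :: real and A :: "real mat"
    assume h: "n \<ge> 1 \<and> A \<in> carrier_mat n n \<and> sdd A \<and> w_max A / w_min A \<le> real n powr C \<and>
      1 / real n < eps \<and> eps < 1"
    then have "dim_row A = n" by blast
    moreover have "good eps A (SOME p. good eps A p)" using good h by blast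
    ultimately show "(\<forall>x\<in>carrier_vec n.
           approximates (SOME p. good eps A p) (\<lambda>s. estimate_words s x) eps (1 / 100) (quad_form A x)) \<and>
        (\<forall>s\<in>set_pmf (SOME p. good eps A p).
           set s \<subseteq> machine_words A \<and>
           real (length s) \<le> soft_bound K 3 (real n / eps powr (8 / 5)))"
      unfolding good_def[of eps A "SOME p. good eps A p"] by simp
  qed
qed

end
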